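(* Let $K$ be a field and let $\Delta$ be a simplicial complex on the vertex set $V(\Delta)=\{x_1,\dots,x_n\}$. For every vertex $x_i$, add to $\Delta$ a number $m_i\geq 1$ of facets $F_{i,1},\dots,F_{i,m_i}$ of dimension $\geq 1$ such that - $F_{i,j}\cap V(\Delta)=\{x_i\}$ for every $i=1,\dots,n$ and $j=1,\dots,m_i$, - $F_{i,j}\cap F_{i,k}=\{x_i\}$ for every $i=1,\dots,n$ and $j,k=1,\dots,m_i$ with $j\neq k$, - $F_{i,j}\cap F_{h,k}=\varnothing$ for all $i,h=1,\dots,n$ with $i\neq h$, $j=1,\dots,m_i$ and $k=1,\dots,m_h$. Let $\Delta'$ be the simplicial complex obtained in this way, i.e. $\Delta'=\Delta\cup\bigcup_{i=1}^n\bigcup_{j=1}^{m_i}\langle F_{i,j}\rangle$, where $\langle F\rangle$ denotes the simplex spanned by $F$ (the set of all subsets of $F$). Let $I(\Delta')$ be the facet ideal of $\Delta'$. Then $$\operatorname{bight} I(\Delta')=\operatorname{ara} I(\Delta').$$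
   Context: Simplicial complexes are finite, and every element of the vertex set is a vertex (i.e. $\{x_i\}\in\Delta$ for all $i$). Vertices of a simplicial complex are identified with indeterminates over the field $K$. A facet is a face that is maximal under inclusion; the dimension of a face $F$ is $|F|-1$. The facet ideal of a simplicial complex $\Gamma$ is the ideal $I(\Gamma)$, in the polynomial ring over $K$ whose indeterminates are the vertices of $\Gamma$, generated by all squarefree monomials $\prod_{v\in F}v$ with $F$ a facet of $\Gamma$. For a proper ideal $I$ of a Noetherian commutative ring $R$ with identity, the arithmetical rank $\operatorname{ara} I$ is the smallest integer $s$ for which there exist $a_1,\dots,a_s\in R$ with $\sqrt{(a_1,\dots,a_s)}=\sqrt{I}$. The big height $\operatorname{bight} I$ is the maximum of the heights of the minimal prime ideals of $I$. *)

theory Defs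
  imports "HOL-Algebra.Ideal" "HOL-Library.Poly_Mapping" "HOL-Library.Extended_Nat"
begin

section \<open>Finite simplicial complexes\<close>

definition simplicial_complex :: "'v set set \<Rightarrow> bool" where
  "simplicial_complex \<Delta> \<longleftrightarrow>
     finite \<Delta> \<and> {} \<in> \<Delta> \<and> (\<forall>F\<in>\<Delta>. finite F \<and> (\<forall>G. G \<subseteq> F \<longrightarrow> G \<in> \<Delta>))"

definition vertices :: "'v set set \<Rightarrow> 'v set" where
  "vertices \<Delta> = {v. {v} \<in> \<Delta>}"

definition facets :: "'v set set \<Rightarrow> 'v set set" where
  "facets \<Delta> = {F \<in> \<Delta>. \<forall>G\<in>\<Delta>. F \<subseteq> G \<longrightarrow> G = F}"

definition face_dim :: "'v set \<Rightarrow> int" where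
  "face_dim F = int (card F) - 1"

definition simplex_on :: "'v set \<Rightarrow> 'v set set" where
  "simplex_on F = Pow F"


section \<open>Polynomial rings\<close>

text \<open>
  A monomial is a finitely supported exponent function, and a polynomial is a finitely supported
  function from monomials to coefficients; the multiplication of \<^typ>\<open>('v \<Rightarrow>\<^sub>0 nat) \<Rightarrow>\<^sub>0 'k\<close> is
  convolution. The polynomial ring with indeterminates \<open>V\<close> consists of the polynomials in which
  only elements of \<open>V\<close> occur.
\<close>

definition mpoly_vars :: "(('v \<Rightarrow>\<^sub>0 nat) \<Rightarrow>\<^sub>0 'k::zero) \<Rightarrow> 'v set" where
  "mpoly_vars p = (\<Union>t\<in>Poly_Mapping.keys p. Poly_Mapping.keys t)"

definition mpoly_ring :: "'v set \<Rightarrow> (('v \<Rightarrow>\<^sub>0 nat) \<Rightarrow>\<^sub>0 'k::field) ring" where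
  "mpoly_ring V =
     \<lparr>carrier = {p. mpoly_vars p \<subseteq> V}, monoid.mult = (*), one = 1, zero = 0, add = (+)\<rparr>"

definition mpoly_var :: "'v \<Rightarrow> (('v \<Rightarrow>\<^sub>0 nat) \<Rightarrow>\<^sub>0 'k::field)" where
  "mpoly_var v = Poly_Mapping.single (Poly_Mapping.single v 1) 1"

lemma mpoly_vars_add: "mpoly_vars (p + q) \<subseteq> mpoly_vars p \<union> mpoly_vars q"
  using Poly_Mapping.keys_add[of p q] by (auto simp: mpoly_vars_def)

lemma mpoly_vars_mult:
  fixes p q :: "('v \<Rightarrow>\<^sub>0 nat) \<Rightarrow>\<^sub>0 'k::field"
  shows "mpoly_vars (p * q) \<subseteq> mpoly_vars p \<union> mpoly_vars q"
proof
  fix v assume "v \<in> mpoly_vars (p * q)"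
  then obtain t where "t \<in> Poly_Mapping.keys (p * q)" and v: "v \<in> Poly_Mapping.keys t"
    by (auto simp: mpoly_vars_def)
  then obtain a b where "t = a + b" and ab: "a \<in> Poly_Mapping.keys p" "b \<in> Poly_Mapping.keys q"
    using keys_mult[of p q] by blast
  then have "v \<in> Poly_Mapping.keys a \<union> Poly_Mapping.keys b"
    using v Poly_Mapping.keys_add[of a b] by blast
  then show "v \<in> mpoly_vars p \<union> mpoly_vars q"
    using ab by (auto simp: mpoly_vars_def)
qed

lemma cring_mpoly_ring: "cring (mpoly_ring V :: (('v \<Rightarrow>\<^sub>0 nat) \<Rightarrow>\<^sub>0 'k::field) ring)"
proof (rule cringI)
  show "abelian_group (mpoly_ring V :: (('v \<Rightarrow>\<^sub>0 nat) \<Rightarrow>\<^sub>0 'k) ring)"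
  proof (rule abelian_groupI)
    fix p :: "('v \<Rightarrow>\<^sub>0 nat) \<Rightarrow>\<^sub>0 'k" assume "p \<in> carrier (mpoly_ring V)"
    then show "\<exists>q\<in>carrier (mpoly_ring V). q \<oplus>\<^bsub>mpoly_ring V\<^esub> p = \<zero>\<^bsub>mpoly_ring V\<^esub>"
      by (intro bexI[of _ "- p"]) (auto simp: mpoly_ring_def mpoly_vars_def)
  next
    fix p q :: "('v \<Rightarrow>\<^sub>0 nat) \<Rightarrow>\<^sub>0 'k"
    assume "p \<in> carrier (mpoly_ring V)" "q \<in> carrier (mpoly_ring V)"
    then show "p \<oplus>\<^bsub>mpoly_ring V\<^esub> q \<in> carrier (mpoly_ring V)"
      using mpoly_vars_add[of p q] by (auto simp: mpoly_ring_def)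
  qed (simp_all add: mpoly_ring_def mpoly_vars_def add_ac)
  show "comm_monoid (mpoly_ring V :: (('v \<Rightarrow>\<^sub>0 nat) \<Rightarrow>\<^sub>0 'k) ring)"
  proof (rule comm_monoidI)
    show "\<one>\<^bsub>mpoly_ring V\<^esub> \<in> carrier (mpoly_ring V :: (('v \<Rightarrow>\<^sub>0 nat) \<Rightarrow>\<^sub>0 'k) ring)"
      by (simp add: mpoly_ring_def mpoly_vars_def)
  next
    fix p q :: "('v \<Rightarrow>\<^sub>0 nat) \<Rightarrow>\<^sub>0 'k"
    assume "p \<in> carrier (mpoly_ring V)" "q \<in> carrier (mpoly_ring V)"
    then show "p \<otimes>\<^bsub>mpoly_ring V\<^esub> q \<in> carrier (mpoly_ring V)"
      using mpoly_vars_mult[of p q] by (auto simp: mpoly_ring_def)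
  qed (simp_all add: mpoly_ring_def mult_ac)
qed (simp add: mpoly_ring_def distrib_right)


section \<open>Ideals of commutative rings\<close>

definition radical :: "('a, 'b) ring_scheme \<Rightarrow> 'a set \<Rightarrow> 'a set" where
  "radical R I = {r \<in> carrier R. \<exists>k::nat. k \<ge> 1 \<and> r [^]\<^bsub>R\<^esub> k \<in> I}"

text \<open>
  The infimum is taken in \<^typ>\<open>enat\<close>: it is the minimum if some \<open>s\<close> has the required property, as
  is always the case over a Noetherian ring, and \<open>\<infinity>\<close> otherwise.
\<close>

definition ara :: "('a, 'b) ring_scheme \<Rightarrow> 'a set \<Rightarrow> enat" where
  "ara R I =
     Inf {enat s | s. \<exists>a :: nat \<Rightarrow> 'a. (\<forall>i\<in>{1..s}. a i \<in> carrier R) \<and>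
            radical R (Idl\<^bsub>R\<^esub> (a ` {1..s})) = radical R I}"

definition minimal_primes :: "('a, 'b) ring_scheme \<Rightarrow> 'a set \<Rightarrow> 'a set set" where
  "minimal_primes R I =
     {P. primeideal P R \<and> I \<subseteq> P \<and> (\<forall>Q. primeideal Q R \<and> I \<subseteq> Q \<and> Q \<subseteq> P \<longrightarrow> Q = P)}"

definition prime_height :: "('a, 'b) ring_scheme \<Rightarrow> 'a set \<Rightarrow> enat" where
  "prime_height R P =
     Sup {enat h | h. \<exists>C :: nat \<Rightarrow> 'a set. (\<forall>i\<le>h. primeideal (C i) R) \<and>
            (\<forall>i<h. C i \<subset> C (Suc i)) \<and> C h = P}"

text \<open>
  A proper ideal has a minimal prime, so whenever the supremum below is finite it is attained,
  and then it is the maximum.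
\<close>

definition bight :: "('a, 'b) ring_scheme \<Rightarrow> 'a set \<Rightarrow> enat" where
  "bight R I = Sup (prime_height R ` minimal_primes R I)"


section \<open>Facet ideals\<close>

definition facet_ideal :: "'v set set \<Rightarrow> (('v \<Rightarrow>\<^sub>0 nat) \<Rightarrow>\<^sub>0 'k::field) set" where
  "facet_ideal \<Gamma> =
     Idl\<^bsub>mpoly_ring (vertices \<Gamma>)\<^esub> ((\<lambda>F. \<Prod>v\<in>F. mpoly_var v) ` facets \<Gamma>)"

end

theory Submission
  imports Defs
begin

text \<open>
  Write \<open>V\<close> for the vertex set of \<open>\<Delta>'\<close>. The facet ideal is generated by squarefree monomials, so
  its minimal primes are generated by the variables in the minimal vertex covers of the set of
  facets (\<open>minimal_primes_sqfree_ideal\<close>), and the height of such a coordinate prime is the number of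
  its variables (\<open>prime_height_coordinate_prime\<close>). The big height is thus the largest size of a
  minimal vertex cover, and three facts give the equality with the arithmetical rank.

  \<^item> The size of a minimal cover \<open>C\<close> is a lower bound for the number of equations
    (\<open>card_minimal_vertex_cover_le_equations\<close>). Setting the variables outside \<open>C\<close> to one turns
    polynomials that define the ideal up to radical into polynomials in the variables \<open>C\<close> whose
    ideal is primary to the origin. Comparing the growth of the dimension of the ring modulo powers
    of the two ideals shows that there are at least as many equations as variables.

  \<^item> Call a set of vertices of \<open>\<Delta>\<close> independent if it contains no facet of \<open>\<Delta>'\<close>. For every independent
    set \<open>S\<close> of indices there is a minimal cover of size \<open>(\<Sum>i\<in>S. m i) + (n - card S)\<close>: take \<open>x i\<close> for
    \<open>i \<notin> S\<close>, and one vertex other than \<open>x i\<close> from each \<open>F i j\<close> with \<open>i \<in> S\<close>. Let \<open>N\<close> be the maximum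
    of these sizes (\<open>minimal_vertex_cover_of_max_size\<close>).

  \<^item> There are \<open>N\<close> equations (\<open>ara_sqfree_ideal_le\<close>). Consider the squarefree monomials of the ideal
    whose support is a union of sets \<open>F i j\<close> over a nonempty set \<open>A\<close> of pairs with independent
    first components, or the set \<open>x ` D\<close> for a dependent set \<open>D\<close>. Put the first kind on level
    \<open>N - card A\<close> and the second kind on level \<open>n - card D\<close>; all levels are smaller than \<open>N\<close>. The
    union of two different supports of the same level contains a support of a smaller level
    (\<open>level_union\<close>). By the argument of Schmitt and Vogel, the sums of the monomials of the levels
    generate the ideal up to radical.
\<close>

section \<open>Polynomials as sums of monomials\<close>

type_synonym ('v, 'k) mpolynomial = "('v \<Rightarrow>\<^sub>0 nat) \<Rightarrow>\<^sub>0 'k"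

abbreviation mpoly_const :: "'k::field \<Rightarrow> ('v, 'k) mpolynomial" where
  "mpoly_const c \<equiv> Poly_Mapping.single 0 c"

lemma mpoly_eq_sum_monomials:
  "p = (\<Sum>t\<in>Poly_Mapping.keys p. Poly_Mapping.single t (Poly_Mapping.lookup p t))"
proof (rule poly_mapping_eqI)
  fix t
  show "Poly_Mapping.lookup p t = Poly_Mapping.lookup
      (\<Sum>t\<in>Poly_Mapping.keys p. Poly_Mapping.single t (Poly_Mapping.lookup p t)) t"
    by (cases "t \<in> Poly_Mapping.keys p")
      (simp_all add: lookup_sum lookup_single when_def in_keys_iff)
qed

lemma keys_sum_subset:
  "Poly_Mapping.keys (\<Sum>i\<in>A. f i) \<subseteq> (\<Union>i\<in>A. Poly_Mapping.keys (f i :: 'a \<Rightarrow>\<^sub>0 'b::comm_monoid_add))"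
proof (induction A rule: infinite_finite_induct)
  case (insert i A)
  then show ?case
    using Poly_Mapping.keys_add[of "f i" "sum f A"] by auto
qed auto

lemma keys_add_nat:
  "Poly_Mapping.keys (s + t) = Poly_Mapping.keys s \<union> Poly_Mapping.keys (t :: 'v \<Rightarrow>\<^sub>0 nat)"
  by (auto simp: in_keys_iff lookup_add)

lemma lookup_mult_sum:
  fixes p q :: "('v, 'k::field) mpolynomial"
  shows "Poly_Mapping.lookup (p * q) t =
    (\<Sum>a\<in>Poly_Mapping.keys p. \<Sum>b\<in>Poly_Mapping.keys q.
       if t = a + b then Poly_Mapping.lookup p a * Poly_Mapping.lookup q b else 0)"
proof -
  have "p * q = (\<Sum>a\<in>Poly_Mapping.keys p. \<Sum>b\<in>Poly_Mapping.keys q.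
      Poly_Mapping.single (a + b) (Poly_Mapping.lookup p a * Poly_Mapping.lookup q b))"
    by (subst (1) mpoly_eq_sum_monomials[of p], subst (1) mpoly_eq_sum_monomials[of q])
      (simp add: sum_product mult_single)
  then show ?thesis
    by (auto simp: lookup_sum lookup_single when_def intro!: sum.cong)
qed

lemma lookup_const_mult:
  "Poly_Mapping.lookup (mpoly_const c * p) t = c * Poly_Mapping.lookup p t"
  by (simp add: mult_map_scale_conv_mult[symmetric] Poly_Mapping.map.rep_eq when_def)

lemma mpoly_vars_single: "mpoly_vars (Poly_Mapping.single t c) \<subseteq> Poly_Mapping.keys t"
  by (auto simp: mpoly_vars_def)

definition sqfree_monomial :: "'v set \<Rightarrow> ('v, 'k::field) mpolynomial" where
  "sqfree_monomial W = (\<Prod>v\<in>W. mpoly_var v)"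

definition sqfree_exponent :: "'v set \<Rightarrow> ('v \<Rightarrow>\<^sub>0 nat)" where
  "sqfree_exponent W = (\<Sum>v\<in>W. Poly_Mapping.single v 1)"

lemma lookup_sqfree_exponent:
  "finite W \<Longrightarrow> Poly_Mapping.lookup (sqfree_exponent W) v = (if v \<in> W then 1 else 0)"
  by (simp add: sqfree_exponent_def lookup_sum lookup_single when_def)

lemma keys_sqfree_exponent: "finite W \<Longrightarrow> Poly_Mapping.keys (sqfree_exponent W) = W"
  by (auto simp: in_keys_iff lookup_sqfree_exponent split: if_splits)

lemma sqfree_monomial_eq_single:
  "finite W \<Longrightarrow> sqfree_monomial W = Poly_Mapping.single (sqfree_exponent W) 1"
proof (induction W rule: finite_induct)
  case (insert v W)
  then show ?case
    by (simp add: sqfree_monomial_def sqfree_exponent_def mpoly_var_def mult_single)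
qed (simp add: sqfree_monomial_def sqfree_exponent_def)

lemma sqfree_monomial_insert:
  "finite W \<Longrightarrow> v \<notin> W \<Longrightarrow> sqfree_monomial (insert v W) = mpoly_var v * sqfree_monomial W"
  by (simp add: sqfree_monomial_def)

lemma sqfree_monomial_mult_eq:
  assumes "finite A" "finite B"
  shows "sqfree_monomial A * sqfree_monomial B = sqfree_monomial (A \<union> B) * sqfree_monomial (A \<inter> B)"
  by (simp add: sqfree_monomial_def prod.union_inter assms)

lemma sqfree_monomial_subset:
  assumes "finite B" "A \<subseteq> B"
  shows "sqfree_monomial B = sqfree_monomial (B - A) * sqfree_monomial A"
  by (simp add: sqfree_monomial_def prod.subset_diff[OF assms(2,1)])

lemma mpoly_vars_sqfree_monomial: "finite W \<Longrightarrow> mpoly_vars (sqfree_monomial W) \<subseteq> W"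
  using mpoly_vars_single keys_sqfree_exponent by (metis sqfree_monomial_eq_single)


section \<open>Ideals of the polynomial ring\<close>

text \<open>
  The operations of \<^term>\<open>mpoly_ring V\<close> are those of the type, so ideals of this ring can be
  handled by closure properties that mention only the type-class operations and
  \<^const>\<open>mpoly_vars\<close>.
\<close>

lemma mpoly_ring_simps [simp]:
  "carrier (mpoly_ring V) = {p. mpoly_vars p \<subseteq> V}"
  "monoid.mult (mpoly_ring V) = (*)"
  "one (mpoly_ring V) = 1"
  "zero (mpoly_ring V) = 0"
  "add (mpoly_ring V) = (+)"
  by (simp_all add: mpoly_ring_def)

lemma ring_mpoly_ring: "ring (mpoly_ring V)"
  by (rule cring.axioms(1)[OF cring_mpoly_ring])

lemma mpoly_ring_pow [simp]: "p [^]\<^bsub>mpoly_ring V\<^esub> (k::nat) = p ^ k"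
proof (induction k)
  case 0
  show ?case using monoid.nat_pow_0[OF ring.is_monoid[OF ring_mpoly_ring], of V p] by simp
next
  case (Suc k)
  then show ?case
    using monoid.nat_pow_Suc[OF ring.is_monoid[OF ring_mpoly_ring], of V p k]
    by (simp add: mult.commute)
qed

lemma keys_minus_eq: "Poly_Mapping.keys (- p) = Poly_Mapping.keys (p :: 'a \<Rightarrow>\<^sub>0 'b::ab_group_add)"
  by (auto simp: in_keys_iff)

lemma mpoly_vars_zero [simp]: "mpoly_vars 0 = {}"
  and mpoly_vars_one [simp]: "mpoly_vars (1 :: ('v, 'k::field) mpolynomial) = {}"
  and mpoly_vars_uminus [simp]: "mpoly_vars (- q) = mpoly_vars (q :: ('v, 'k) mpolynomial)"
  by (simp_all add: mpoly_vars_def keys_minus_eq)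

lemma mpoly_vars_addI: "mpoly_vars p \<subseteq> V \<Longrightarrow> mpoly_vars q \<subseteq> V \<Longrightarrow> mpoly_vars (p + q) \<subseteq> V"
  using mpoly_vars_add[of p q] by auto

lemma mpoly_vars_multI:
  "mpoly_vars p \<subseteq> V \<Longrightarrow> mpoly_vars q \<subseteq> V \<Longrightarrow> mpoly_vars (p * q) \<subseteq> V"
  for p q :: "('v, 'k::field) mpolynomial"
  using mpoly_vars_mult[of p q] by auto

lemma mpoly_vars_powerI: "mpoly_vars p \<subseteq> V \<Longrightarrow> mpoly_vars (p ^ k) \<subseteq> V"
  for p :: "('v, 'k::field) mpolynomial"
  by (induction k) (simp_all add: mpoly_vars_multI)

lemma mpoly_vars_sumI: "(\<And>i. i \<in> A \<Longrightarrow> mpoly_vars (f i) \<subseteq> V) \<Longrightarrow> mpoly_vars (\<Sum>i\<in>A. f i) \<subseteq> V"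
  by (induction A rule: infinite_finite_induct) (simp_all add: mpoly_vars_addI)

lemma mpoly_vars_prodI: "(\<And>i. i \<in> A \<Longrightarrow> mpoly_vars (f i) \<subseteq> V) \<Longrightarrow> mpoly_vars (\<Prod>i\<in>A. f i) \<subseteq> V"
  for f :: "'i \<Rightarrow> ('v, 'k::field) mpolynomial"
  by (induction A rule: infinite_finite_induct) (simp_all add: mpoly_vars_multI)

lemma ideal_mpolyI:
  fixes J :: "('v, 'k::field) mpolynomial set"
  assumes sub: "\<And>p. p \<in> J \<Longrightarrow> mpoly_vars p \<subseteq> V" and zero: "0 \<in> J"
    and add: "\<And>p q. p \<in> J \<Longrightarrow> q \<in> J \<Longrightarrow> p + q \<in> J"
    and mult: "\<And>p q. p \<in> J \<Longrightarrow> mpoly_vars q \<subseteq> V \<Longrightarrow> q * p \<in> J"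
  shows "ideal J (mpoly_ring V)"
proof (rule idealI)
  interpret R: ring "mpoly_ring V :: ('v, 'k) mpolynomial ring"
    by (rule ring_mpoly_ring)
  show "subgroup J (add_monoid (mpoly_ring V))"
  proof (rule R.add.subgroupI)
    fix p assume p: "p \<in> J"
    have "- p \<in> J" using mult[OF p, of "- 1"] by simp
    moreover have "\<ominus>\<^bsub>mpoly_ring V\<^esub> p = - p"
      by (rule R.minus_equality) (use sub[OF p] in simp_all)
    ultimately show "\<ominus>\<^bsub>mpoly_ring V\<^esub> p \<in> J" by simp
  qed (use assms in auto)
qed (use assms in \<open>auto simp: ring_mpoly_ring mult.commute\<close>)

lemma
  fixes J :: "('v, 'k::field) mpolynomial set"
  assumes "ideal J (mpoly_ring V)"
  shows ideal_mpoly_vars: "p \<in> J \<Longrightarrow> mpoly_vars p \<subseteq> V"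
    and ideal_mpoly_zero: "0 \<in> J"
    and ideal_mpoly_mult: "p \<in> J \<Longrightarrow> mpoly_vars q \<subseteq> V \<Longrightarrow> q * p \<in> J"
    and ideal_mpoly_diff: "p \<in> J \<Longrightarrow> q \<in> J \<Longrightarrow> p - q \<in> J"
    and ideal_mpoly_sum: "(\<And>i. i \<in> A \<Longrightarrow> f i \<in> J) \<Longrightarrow> (\<Sum>i\<in>A. f i) \<in> J"
proof -
  interpret J: ideal J "mpoly_ring V" by fact
  show vars: "mpoly_vars p \<subseteq> V" if "p \<in> J" for p using J.Icarr[OF that] by simp
  show zero: "0 \<in> J" using additive_subgroup.zero_closed[OF J.is_additive_subgroup] by simp
  have add: "p + q \<in> J" if "p \<in> J" "q \<in> J" for p q
    using additive_subgroup.a_closed[OF J.is_additive_subgroup that] by simp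
  show mult: "q * p \<in> J" if "p \<in> J" "mpoly_vars q \<subseteq> V" for p q
    using J.I_l_closed[OF that(1), of q] that(2) by simp
  show "p - q \<in> J" if "p \<in> J" "q \<in> J"
    using add[OF that(1) mult[OF that(2), of "- 1"]] by simp
  show "(\<Sum>i\<in>A. f i) \<in> J" if "\<And>i. i \<in> A \<Longrightarrow> f i \<in> J"
    using that by (induction A rule: infinite_finite_induct) (simp_all add: zero add)
qed

lemma
  fixes P :: "('v, 'k::field) mpolynomial set"
  assumes "primeideal P (mpoly_ring V)"
  shows primeideal_mpoly_ideal: "ideal P (mpoly_ring V)"
    and primeideal_mpoly_one: "1 \<notin> P"
    and primeideal_mpoly_prime:
      "mpoly_vars p \<subseteq> V \<Longrightarrow> mpoly_vars q \<subseteq> V \<Longrightarrow> p * q \<in> P \<Longrightarrow> p \<in> P \<or> q \<in> P"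
proof -
  interpret P: primeideal P "mpoly_ring V" by fact
  show "ideal P (mpoly_ring V)" by (rule P.is_ideal)
  show "1 \<notin> P" using P.one_imp_carrier P.I_notcarr by auto
  show "p \<in> P \<or> q \<in> P" if "mpoly_vars p \<subseteq> V" "mpoly_vars q \<subseteq> V" "p * q \<in> P"
    using P.I_prime[of p q] that by simp
qed

lemma primeideal_mpolyI:
  fixes P :: "('v, 'k::field) mpolynomial set"
  assumes "ideal P (mpoly_ring V)" "1 \<notin> P"
    and "\<And>p q. mpoly_vars p \<subseteq> V \<Longrightarrow> mpoly_vars q \<subseteq> V \<Longrightarrow> p * q \<in> P \<Longrightarrow> p \<in> P \<or> q \<in> P"
  shows "primeideal P (mpoly_ring V)"
proof (rule primeidealI[OF assms(1) cring_mpoly_ring])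
  show "carrier (mpoly_ring V) \<noteq> P" using assms(2) by auto
qed (use assms(3) in auto)

lemma primeideal_mpoly_power:
  fixes P :: "('v, 'k::field) mpolynomial set"
  assumes P: "primeideal P (mpoly_ring V)" and "mpoly_vars p \<subseteq> V" "p ^ k \<in> P"
  shows "p \<in> P"
  using assms(3)
proof (induction k)
  case (Suc k)
  then show ?case
    using primeideal_mpoly_prime[OF P assms(2) mpoly_vars_powerI[OF assms(2)]] by auto
qed (use primeideal_mpoly_one[OF P] in simp)

lemma primeideal_sqfree_monomial:
  fixes P :: "('v, 'k::field) mpolynomial set"
  assumes P: "primeideal P (mpoly_ring V)" and "finite W" "W \<subseteq> V" "sqfree_monomial W \<in> P"
  shows "\<exists>v\<in>W. mpoly_var v \<in> P"
  using assms(2-)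
proof (induction W rule: finite_induct)
  case (insert v W)
  have "mpoly_vars (mpoly_var v :: ('v, 'k) mpolynomial) \<subseteq> V"
    using insert by (auto simp: mpoly_vars_def mpoly_var_def)
  moreover have "mpoly_vars (sqfree_monomial W :: ('v, 'k) mpolynomial) \<subseteq> V"
    using insert mpoly_vars_sqfree_monomial by blast
  ultimately show ?case
    using insert primeideal_mpoly_prime[OF P] by (auto simp: sqfree_monomial_insert)
qed (use primeideal_mpoly_one[OF P] in \<open>simp add: sqfree_monomial_def\<close>)

lemma genideal_mpoly_combination:
  fixes a :: "nat \<Rightarrow> ('v, 'k::field) mpolynomial"
  assumes a: "\<And>i. i \<in> A \<Longrightarrow> mpoly_vars (a i) \<subseteq> V" and "finite A"
    and p: "p \<in> Idl\<^bsub>mpoly_ring V\<^esub> (a ` A)"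
  obtains g where "\<And>i. i \<in> A \<Longrightarrow> mpoly_vars (g i) \<subseteq> V" "p = (\<Sum>i\<in>A. a i * g i)"
proof -
  define J where "J = {\<Sum>i\<in>A. a i * g i | g. \<forall>i\<in>A. mpoly_vars (g i) \<subseteq> V}"
  have "ideal J (mpoly_ring V)"
  proof (rule ideal_mpolyI)
    fix p assume "p \<in> J"
    then obtain g where "p = (\<Sum>i\<in>A. a i * g i)" "\<forall>i\<in>A. mpoly_vars (g i) \<subseteq> V"
      unfolding J_def by auto
    then show "mpoly_vars p \<subseteq> V"
      using a by (simp add: mpoly_vars_sumI mpoly_vars_multI)
  next
    show "0 \<in> J" unfolding J_def by (intro CollectI exI[of _ "\<lambda>_. 0"]) auto
  next
    fix p q assume "p \<in> J" "q \<in> J"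
    then obtain g h where "p = (\<Sum>i\<in>A. a i * g i)" "q = (\<Sum>i\<in>A. a i * h i)"
      "\<forall>i\<in>A. mpoly_vars (g i) \<subseteq> V" "\<forall>i\<in>A. mpoly_vars (h i) \<subseteq> V"
      unfolding J_def by auto
    then show "p + q \<in> J"
      unfolding J_def by (intro CollectI exI[of _ "\<lambda>i. g i + h i"])
        (auto simp: sum.distrib distrib_left mpoly_vars_addI)
  next
    fix p q :: "('v, 'k) mpolynomial" assume "p \<in> J" and q: "mpoly_vars q \<subseteq> V"
    then obtain g where "p = (\<Sum>i\<in>A. a i * g i)" "\<forall>i\<in>A. mpoly_vars (g i) \<subseteq> V"
      unfolding J_def by auto
    then show "q * p \<in> J"
      unfolding J_def using q by (intro CollectI exI[of _ "\<lambda>i. q * g i"])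
        (auto simp: sum_distrib_left mult_ac mpoly_vars_multI)
  qed
  moreover have "a ` A \<subseteq> J"
  proof
    fix y assume "y \<in> a ` A"
    then obtain j where j: "j \<in> A" "y = a j" by auto
    show "y \<in> J"
      unfolding J_def using j assms(2)
      by (intro CollectI exI[of _ "\<lambda>i. if i = j then 1 else 0"]) (simp add: if_distrib cong: if_cong)
  qed
  ultimately have "Idl\<^bsub>mpoly_ring V\<^esub> (a ` A) \<subseteq> J"
    by (rule ring.genideal_minimal[OF ring_mpoly_ring])
  then have "p \<in> J" using p by blast
  then obtain g where "p = (\<Sum>i\<in>A. a i * g i)" "\<forall>i\<in>A. mpoly_vars (g i) \<subseteq> V"
    unfolding J_def by auto
  then show ?thesis using that[of g] by simp
qed


section \<open>Radicals\<close>

lemma ideal_radical: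
  fixes J :: "('v, 'k::field) mpolynomial set"
  assumes J: "ideal J (mpoly_ring V)"
  shows "ideal (radical (mpoly_ring V) J) (mpoly_ring V)"
proof (rule ideal_mpolyI)
  show "0 \<in> radical (mpoly_ring V) J"
    using ideal_mpoly_zero[OF J] by (auto simp: radical_def intro!: exI[of _ 1])
next
  fix p q assume "p \<in> radical (mpoly_ring V) J" "q \<in> radical (mpoly_ring V) J"
  then obtain k l where p: "mpoly_vars p \<subseteq> V" "p ^ k \<in> J" "k \<ge> 1"
    and q: "mpoly_vars q \<subseteq> V" "q ^ l \<in> J"
    by (auto simp: radical_def)
  \<comment> \<open>In each term of the binomial expansion of the power \<open>k + l\<close>, one of the two exponents is
    large.\<close>
  have "of_nat ((k + l) choose i) * p ^ i * q ^ (k + l - i) \<in> J" if "i \<le> k + l" for i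
  proof -
    have c: "mpoly_vars (of_nat m :: ('v, 'k) mpolynomial) \<subseteq> V" for m
      by (induction m) (simp_all add: mpoly_vars_addI)
    show ?thesis
    proof (cases "k \<le> i")
      case True
      then have "p ^ i = p ^ (i - k) * p ^ k" by (simp flip: power_add)
      then have "of_nat ((k + l) choose i) * p ^ i * q ^ (k + l - i) =
          (of_nat ((k + l) choose i) * p ^ (i - k) * q ^ (k + l - i)) * p ^ k"
        by (simp add: mult_ac)
      then show ?thesis
        by (simp only:) (intro ideal_mpoly_mult[OF J p(2)] mpoly_vars_multI c mpoly_vars_powerI p q)
    next
      case False
      then have "q ^ (k + l - i) = q ^ (k - i) * q ^ l" by (simp flip: power_add)
      then have "of_nat ((k + l) choose i) * p ^ i * q ^ (k + l - i) =
          (of_nat ((k + l) choose i) * p ^ i * q ^ (k - i)) * q ^ l"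
        by (simp add: mult_ac)
      then show ?thesis
        by (simp only:) (intro ideal_mpoly_mult[OF J q(2)] mpoly_vars_multI c mpoly_vars_powerI p q)
    qed
  qed
  then have "(p + q) ^ (k + l) \<in> J"
    unfolding binomial_ring by (intro ideal_mpoly_sum[OF J]) auto
  moreover have "k + l \<ge> 1" using p by simp
  ultimately show "p + q \<in> radical (mpoly_ring V) J"
    using mpoly_vars_addI[OF p(1) q(1)] by (auto simp: radical_def)
next
  fix p q :: "('v, 'k) mpolynomial"
  assume "p \<in> radical (mpoly_ring V) J" and q: "mpoly_vars q \<subseteq> V"
  then show "q * p \<in> radical (mpoly_ring V) J"
    using ideal_mpoly_mult[OF J _ mpoly_vars_powerI[OF q]]
    by (auto simp: radical_def power_mult_distrib mpoly_vars_multI)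
qed (auto simp: radical_def)

lemma radical_power_cancel:
  assumes "p ^ k \<in> radical (mpoly_ring V) J" "k \<ge> 1" "mpoly_vars p \<subseteq> V"
  shows "p \<in> radical (mpoly_ring V) J"
proof -
  obtain l where "l \<ge> 1" "(p ^ k) ^ l \<in> J"
    using assms(1) by (auto simp: radical_def)
  then show ?thesis
    using assms by (auto simp: radical_def simp flip: power_mult intro!: exI[of _ "k * l"])
qed

lemma radical_subset:
  assumes "J \<subseteq> radical (mpoly_ring V) J'"
  shows "radical (mpoly_ring V) J \<subseteq> radical (mpoly_ring V) J'"
proof
  fix p assume "p \<in> radical (mpoly_ring V) J"
  then obtain k where "p ^ k \<in> J" "k \<ge> 1" "mpoly_vars p \<subseteq> V" by (auto simp: radical_def)
  then show "p \<in> radical (mpoly_ring V) J'"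
    using radical_power_cancel[of p k V J'] assms by auto
qed

lemma subset_radical:
  assumes "ideal J (mpoly_ring V)"
  shows "J \<subseteq> radical (mpoly_ring V) J"
proof
  fix p assume "p \<in> J"
  then have "p ^ 1 \<in> J" "mpoly_vars p \<subseteq> V" using ideal_mpoly_vars[OF assms] by auto
  then show "p \<in> radical (mpoly_ring V) J"
    unfolding radical_def mpoly_ring_pow mpoly_ring_simps by blast
qed


section \<open>Coordinate primes\<close>

definition coordinate_prime :: "'v set \<Rightarrow> 'v set \<Rightarrow> ('v, 'k::field) mpolynomial set" where
  "coordinate_prime V C =
     {p. mpoly_vars p \<subseteq> V \<and> (\<forall>t\<in>Poly_Mapping.keys p. Poly_Mapping.keys t \<inter> C \<noteq> {})}"

text \<open>
  The variables carry no order, hence there is no leading monomial. The following substitute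
  suffices to see that a product of nonzero polynomials is nonzero: restrict both sets to the
  elements with the largest exponent in one variable, and recurse on the remaining variables.
\<close>

lemma unique_exponent_sum:
  fixes A B :: "('v \<Rightarrow>\<^sub>0 nat) set"
  assumes "finite U" "finite A" "A \<noteq> {}" "finite B" "B \<noteq> {}"
    and "\<And>s t v. s \<in> A \<Longrightarrow> t \<in> A \<Longrightarrow> v \<notin> U \<Longrightarrow> Poly_Mapping.lookup s v = Poly_Mapping.lookup t v"
    and "\<And>s t v. s \<in> B \<Longrightarrow> t \<in> B \<Longrightarrow> v \<notin> U \<Longrightarrow> Poly_Mapping.lookup s v = Poly_Mapping.lookup t v"
  shows "\<exists>a\<in>A. \<exists>b\<in>B. \<forall>a'\<in>A. \<forall>b'\<in>B. a' + b' = a + b \<longrightarrow> a' = a \<and> b' = b"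
  using assms
proof (induction U arbitrary: A B rule: finite_induct)
  case empty
  then obtain a b where ab: "a \<in> A" "b \<in> B" by blast
  have "a' = a" if "a' \<in> A" for a' using empty(5) ab that by (intro poly_mapping_eqI) blast
  moreover have "b' = b" if "b' \<in> B" for b' using empty(6) ab that by (intro poly_mapping_eqI) blast
  ultimately show ?case using ab by blast
next
  case (insert v U)
  define ma where "ma = Max ((\<lambda>t. Poly_Mapping.lookup t v) ` A)"
  define mb where "mb = Max ((\<lambda>t. Poly_Mapping.lookup t v) ` B)"
  define A' where "A' = {t \<in> A. Poly_Mapping.lookup t v = ma}"
  define B' where "B' = {t \<in> B. Poly_Mapping.lookup t v = mb}"
  have ma: "Poly_Mapping.lookup t v \<le> ma" if "t \<in> A" for t
    unfolding ma_def using that insert.prems by (intro Max_ge) auto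
  have mb: "Poly_Mapping.lookup t v \<le> mb" if "t \<in> B" for t
    unfolding mb_def using that insert.prems by (intro Max_ge) auto
  have "ma \<in> (\<lambda>t. Poly_Mapping.lookup t v) ` A"
    unfolding ma_def using insert.prems by (intro Max_in) auto
  then have A': "finite A'" "A' \<noteq> {}" "A' \<subseteq> A" using insert.prems by (auto simp: A'_def)
  have "mb \<in> (\<lambda>t. Poly_Mapping.lookup t v) ` B"
    unfolding mb_def using insert.prems by (intro Max_in) auto
  then have B': "finite B'" "B' \<noteq> {}" "B' \<subseteq> B" using insert.prems by (auto simp: B'_def)
  have "\<exists>a\<in>A'. \<exists>b\<in>B'. \<forall>a'\<in>A'. \<forall>b'\<in>B'. a' + b' = a + b \<longrightarrow> a' = a \<and> b' = b"
  proof (rule insert.IH)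
    show "Poly_Mapping.lookup s u = Poly_Mapping.lookup t u"
      if "s \<in> A'" "t \<in> A'" "u \<notin> U" for s t u
      using that insert.prems(5)[of s t u] by (cases "u = v") (auto simp: A'_def)
    show "Poly_Mapping.lookup s u = Poly_Mapping.lookup t u"
      if "s \<in> B'" "t \<in> B'" "u \<notin> U" for s t u
      using that insert.prems(6)[of s t u] by (cases "u = v") (auto simp: B'_def)
  qed (use A' B' in auto)
  then obtain a b where ab: "a \<in> A'" "b \<in> B'"
    and unique: "\<And>a' b'. a' \<in> A' \<Longrightarrow> b' \<in> B' \<Longrightarrow> a' + b' = a + b \<Longrightarrow> a' = a \<and> b' = b"
    by blast
  have "a' = a \<and> b' = b" if "a' \<in> A" "b' \<in> B" "a' + b' = a + b" for a' b'
  proof (rule unique)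
    have "Poly_Mapping.lookup a' v + Poly_Mapping.lookup b' v = ma + mb"
      using ab that(3) by (metis (mono_tags, lifting) A'_def B'_def lookup_add mem_Collect_eq)
    then show "a' \<in> A'" "b' \<in> B'"
      using ma[OF that(1)] mb[OF that(2)] that by (auto simp: A'_def B'_def)
  qed (fact that)
  then show ?case using ab A' B' by blast
qed

lemma ideal_coordinate_prime:
  "ideal (coordinate_prime V C :: ('v, 'k::field) mpolynomial set) (mpoly_ring V)"
proof (rule ideal_mpolyI)
  fix p q :: "('v, 'k) mpolynomial"
  assume p: "p \<in> coordinate_prime V C"
  then show "mpoly_vars p \<subseteq> V" by (simp add: coordinate_prime_def)
  show "p + q \<in> coordinate_prime V C" if "q \<in> coordinate_prime V C"
    using p that Poly_Mapping.keys_add[of p q] mpoly_vars_add[of p q] by (auto simp: coordinate_prime_def)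
  show "q * p \<in> coordinate_prime V C" if "mpoly_vars q \<subseteq> V"
  proof -
    have "Poly_Mapping.keys t \<inter> C \<noteq> {}" if "t \<in> Poly_Mapping.keys (q * p)" for t
      using p that keys_mult[of q p] by (fastforce simp: coordinate_prime_def keys_add_nat)
    then show ?thesis using p that by (simp add: coordinate_prime_def mpoly_vars_multI)
  qed
qed (auto simp: coordinate_prime_def)

text \<open>
  Among the monomials of \<open>p\<close> and of \<open>q\<close> that avoid \<open>C\<close>, choose two whose product arises in only
  one way. This product avoids \<open>C\<close>, and monomials that meet \<open>C\<close> do not contribute to it, so it
  survives in \<open>p * q\<close>.
\<close>

lemma primeideal_coordinate_prime:
  "primeideal (coordinate_prime V C :: ('v, 'k::field) mpolynomial set) (mpoly_ring V)"
proof (rule primeideal_mpolyI[OF ideal_coordinate_prime])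
  show "(1 :: ('v, 'k) mpolynomial) \<notin> coordinate_prime V C"
    by (simp add: coordinate_prime_def)
next
  fix p q :: "('v, 'k) mpolynomial"
  assume vars: "mpoly_vars p \<subseteq> V" "mpoly_vars q \<subseteq> V" and pq: "p * q \<in> coordinate_prime V C"
  show "p \<in> coordinate_prime V C \<or> q \<in> coordinate_prime V C"
  proof (rule ccontr)
    assume neg: "\<not> ?thesis"
    define A where "A = {t \<in> Poly_Mapping.keys p. Poly_Mapping.keys t \<inter> C = {}}"
    define B where "B = {t \<in> Poly_Mapping.keys q. Poly_Mapping.keys t \<inter> C = {}}"
    define U where "U = (\<Union>t\<in>A \<union> B. Poly_Mapping.keys t)"
    have fin: "finite A" "finite B" "A \<noteq> {}" "B \<noteq> {}"
      using neg vars by (auto simp: A_def B_def coordinate_prime_def)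
    have "\<exists>a\<in>A. \<exists>b\<in>B. \<forall>a'\<in>A. \<forall>b'\<in>B. a' + b' = a + b \<longrightarrow> a' = a \<and> b' = b"
    proof (rule unique_exponent_sum[of U])
      show "Poly_Mapping.lookup s v = Poly_Mapping.lookup t v"
        if "s \<in> A" "t \<in> A" "v \<notin> U" for s t v
        using that by (auto simp: U_def in_keys_iff)
      show "Poly_Mapping.lookup s v = Poly_Mapping.lookup t v"
        if "s \<in> B" "t \<in> B" "v \<notin> U" for s t v
        using that by (auto simp: U_def in_keys_iff)
    qed (use fin in \<open>auto simp: U_def\<close>)
    then obtain a b where ab: "a \<in> A" "b \<in> B"
      and unique: "\<And>a' b'. a' \<in> A \<Longrightarrow> b' \<in> B \<Longrightarrow> a' + b' = a + b \<Longrightarrow> a' = a \<and> b' = b"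
      by blast
    have only: "a' = a \<and> b' = b"
      if "a' \<in> Poly_Mapping.keys p" "b' \<in> Poly_Mapping.keys q" "a + b = a' + b'" for a' b'
    proof (rule unique)
      have "Poly_Mapping.keys (a' + b') \<inter> C = {}"
        using ab unfolding that(3)[symmetric] by (auto simp: A_def B_def keys_add_nat)
      then show "a' \<in> A" "b' \<in> B" using that by (auto simp: A_def B_def keys_add_nat)
    qed (simp add: that)
    have "Poly_Mapping.lookup (p * q) (a + b) =
        (\<Sum>a'\<in>Poly_Mapping.keys p. \<Sum>b'\<in>Poly_Mapping.keys q.
          if a' = a \<and> b' = b then Poly_Mapping.lookup p a * Poly_Mapping.lookup q b else 0)"
      unfolding lookup_mult_sum by (intro sum.cong refl) (use only in auto)
    also have "\<dots> = (\<Sum>a'\<in>Poly_Mapping.keys p. if a' = a then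
        (\<Sum>b'\<in>Poly_Mapping.keys q. if b' = b then Poly_Mapping.lookup p a * Poly_Mapping.lookup q b else 0)
        else 0)"
      by (intro sum.cong refl) auto
    also have "\<dots> = Poly_Mapping.lookup p a * Poly_Mapping.lookup q b"
      using ab by (simp add: A_def B_def)
    also have "\<dots> \<noteq> 0" using ab by (simp add: A_def B_def in_keys_iff)
    finally have "a + b \<in> Poly_Mapping.keys (p * q)" by (simp add: in_keys_iff)
    moreover have "Poly_Mapping.keys (a + b) \<inter> C = {}"
      using ab by (auto simp: A_def B_def keys_add_nat)
    ultimately show False using pq by (auto simp: coordinate_prime_def)
  qed
qed

lemma sqfree_monomial_in_coordinate_prime_iff:
  assumes "finite W" "W \<subseteq> V"
  shows "sqfree_monomial W \<in> coordinate_prime V C \<longleftrightarrow> W \<inter> C \<noteq> {}"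
  using assms mpoly_vars_sqfree_monomial[OF assms(1)]
  by (auto simp: coordinate_prime_def sqfree_monomial_eq_single keys_sqfree_exponent)

lemma mpoly_var_eq_sqfree_monomial: "mpoly_var v = sqfree_monomial {v}"
  by (simp add: sqfree_monomial_def)

lemma single_eq_var_mult:
  assumes "v \<in> Poly_Mapping.keys t"
  shows "Poly_Mapping.single t (c :: 'k::field) =
    Poly_Mapping.single (t - Poly_Mapping.single v 1) c * mpoly_var v"
proof -
  have "t - Poly_Mapping.single v 1 + Poly_Mapping.single v 1 = t"
    using assms by (intro poly_mapping_eqI) (auto simp: lookup_add lookup_minus lookup_single when_def in_keys_iff)
  then show ?thesis by (simp add: mpoly_var_def mult_single)
qed

lemma coordinate_prime_least:
  assumes J: "ideal J (mpoly_ring V)" and "\<And>v. v \<in> C \<Longrightarrow> mpoly_var v \<in> J"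
  shows "coordinate_prime V C \<subseteq> J"
proof
  fix p :: "('a, 'b) mpolynomial" assume p: "p \<in> coordinate_prime V C"
  have "Poly_Mapping.single t (Poly_Mapping.lookup p t) \<in> J" if t: "t \<in> Poly_Mapping.keys p" for t
  proof -
    obtain v where v: "v \<in> Poly_Mapping.keys t" "v \<in> C"
      using p t by (auto simp: coordinate_prime_def)
    have "Poly_Mapping.keys (t - Poly_Mapping.single v 1) \<subseteq> Poly_Mapping.keys t"
      by (auto simp: in_keys_iff lookup_minus)
    moreover have "Poly_Mapping.keys t \<subseteq> V"
      using p t by (auto simp: coordinate_prime_def mpoly_vars_def)
    ultimately have "mpoly_vars (Poly_Mapping.single (t - Poly_Mapping.single v 1)
        (Poly_Mapping.lookup p t)) \<subseteq> V"
      by (intro order_trans[OF mpoly_vars_single]) simp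
    then show ?thesis
      unfolding single_eq_var_mult[OF v(1), of "Poly_Mapping.lookup p t"]
      by (rule ideal_mpoly_mult[OF J assms(2)[OF v(2)]])
  qed
  then show "p \<in> J"
    by (subst mpoly_eq_sum_monomials[of p]) (rule ideal_mpoly_sum[OF J])
qed

lemma coordinate_prime_mono: "C \<subseteq> D \<Longrightarrow> coordinate_prime V C \<subseteq> coordinate_prime V D"
  unfolding coordinate_prime_def by blast

lemma coordinate_prime_strict:
  assumes "C \<subset> D" "D \<subseteq> V"
  shows "(coordinate_prime V C :: ('v, 'k::field) mpolynomial set) \<subset> coordinate_prime V D"
proof -
  obtain v where v: "v \<in> D" "v \<notin> C" using assms by auto
  then have "(mpoly_var v :: ('v, 'k) mpolynomial) \<in> coordinate_prime V D"
    "(mpoly_var v :: ('v, 'k) mpolynomial) \<notin> coordinate_prime V C"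
    using assms by (auto simp: mpoly_var_eq_sqfree_monomial sqfree_monomial_in_coordinate_prime_iff)
  then show ?thesis using coordinate_prime_mono[of C D V] assms by blast
qed


section \<open>Counting\<close>

lemma underdetermined_system_solvable:
  fixes M :: "'a \<Rightarrow> 'b \<Rightarrow> 'k::field"
  assumes "finite B" "finite A" "card B < card A"
  shows "\<exists>c. (\<exists>a\<in>A. c a \<noteq> 0) \<and> (\<forall>b\<in>B. (\<Sum>a\<in>A. c a * M a b) = 0)"
  using assms
proof (induction B arbitrary: A M rule: finite_induct)
  case empty
  then have "A \<noteq> {}" by auto
  then show ?case by (intro exI[of _ "\<lambda>_. 1"]) auto
next
  case (insert b B)
  show ?case
  proof (cases "\<forall>a\<in>A. M a b = 0")
    case True
    have "card B < card A" using insert by simp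
    from insert.IH[OF insert.prems(1) this, of M] True show ?thesis by auto
  next
    case False
    then obtain a0 where a0: "a0 \<in> A" "M a0 b \<noteq> 0" by blast
    define A' where "A' = A - {a0}"
    have A: "A = insert a0 A'" "a0 \<notin> A'" "finite A'" using a0 insert.prems by (auto simp: A'_def)
    \<comment> \<open>Eliminate the unknown of \<open>a0\<close> by means of the equation of \<open>b\<close>.\<close>
    have "card B < card A'" using insert A by simp
    from insert.IH[OF A(3) this, of "\<lambda>a b'. M a b' - M a b / M a0 b * M a0 b'"]
    obtain c where c: "\<exists>a\<in>A'. c a \<noteq> 0"
      "\<And>b'. b' \<in> B \<Longrightarrow> (\<Sum>a\<in>A'. c a * (M a b' - M a b / M a0 b * M a0 b')) = 0"
      by blast
    define s where "s = (\<Sum>a\<in>A'. c a * M a b) / M a0 b"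
    define d where "d = c(a0 := - s)"
    have d: "(\<Sum>a\<in>A. d a * M a b') = (\<Sum>a\<in>A'. c a * M a b') - s * M a0 b'" for b'
    proof -
      have "(\<Sum>a\<in>A'. d a * M a b') = (\<Sum>a\<in>A'. c a * M a b')"
        using A by (intro sum.cong) (auto simp: d_def)
      then show ?thesis using A by (simp add: d_def)
    qed
    have "(\<Sum>a\<in>A. d a * M a b') = 0" if "b' \<in> insert b B" for b'
    proof (cases "b' = b")
      case True
      then show ?thesis using a0 by (simp add: d s_def)
    next
      case False
      have "(\<Sum>a\<in>A'. c a * (M a b' - M a b / M a0 b * M a0 b')) =
          (\<Sum>a\<in>A'. c a * M a b') - s * M a0 b'"
        by (simp add: right_diff_distrib sum_subtractf s_def sum_divide_distrib sum_distrib_right)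
          (simp add: mult_ac)
      then show ?thesis using c(2) that False by (simp add: d)
    qed
    moreover have "\<exists>a\<in>A. d a \<noteq> 0" using c(1) A by (auto simp: d_def)
    ultimately show ?thesis by blast
  qed
qed

text \<open>
  Boxes of exponents replace simplices of bounded total degree in the dimension counts: their
  cardinalities are plain powers.
\<close>

definition exponent_box :: "'v set \<Rightarrow> nat \<Rightarrow> ('v \<Rightarrow>\<^sub>0 nat) set" where
  "exponent_box C e = {t. Poly_Mapping.keys t \<subseteq> C \<and> (\<forall>v\<in>C. Poly_Mapping.lookup t v < e)}"

lemma bij_betw_exponent_box:
  assumes "finite C"
  shows "bij_betw (\<lambda>t. restrict (Poly_Mapping.lookup t) C) (exponent_box C e) (C \<rightarrow>\<^sub>E {..<e})"
proof (rule bij_betwI[where g = "\<lambda>f. \<Sum>v\<in>C. Poly_Mapping.single v (f v)"])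
  have lookup: "Poly_Mapping.lookup (\<Sum>v\<in>C. Poly_Mapping.single v (f v)) u = (if u \<in> C then f u else 0)"
    for f :: "'a \<Rightarrow> nat" and u
    using assms by (simp add: lookup_sum lookup_single when_def)
  show "(\<lambda>f. \<Sum>v\<in>C. Poly_Mapping.single v (f v)) \<in> (C \<rightarrow>\<^sub>E {..<e}) \<rightarrow> exponent_box C e"
  proof
    fix f assume "f \<in> C \<rightarrow>\<^sub>E {..<e}"
    then show "(\<Sum>v\<in>C. Poly_Mapping.single v (f v)) \<in> exponent_box C e"
      by (auto simp: exponent_box_def lookup in_keys_iff split: if_splits)
  qed
  show "restrict (Poly_Mapping.lookup (\<Sum>v\<in>C. Poly_Mapping.single v (f v))) C = f"
    if "f \<in> C \<rightarrow>\<^sub>E {..<e}" for f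
    using that by (auto simp: lookup fun_eq_iff restrict_def PiE_def extensional_def)
  show "(\<Sum>v\<in>C. Poly_Mapping.single v (restrict (Poly_Mapping.lookup t) C v)) = t"
    if "t \<in> exponent_box C e" for t
    using that by (intro poly_mapping_eqI) (auto simp: lookup exponent_box_def in_keys_iff)
qed (auto simp: exponent_box_def)

lemma
  assumes "finite C"
  shows finite_exponent_box: "finite (exponent_box C e)"
    and card_exponent_box: "card (exponent_box C e) = e ^ card C"
proof -
  have "finite (C \<rightarrow>\<^sub>E {..<e})" using assms by (intro finite_PiE) auto
  then show "finite (exponent_box C e)"
    using bij_betw_finite[OF bij_betw_exponent_box[OF assms]] by blast
  show "card (exponent_box C e) = e ^ card C"
    using bij_betw_same_card[OF bij_betw_exponent_box[OF assms]] assms by (simp add: card_PiE)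
qed

text \<open>Both dimension counts end with this comparison of growth rates; \<open>K + 1\<close> already violates the
  bound if \<open>s < c\<close>.\<close>

lemma power_bound_imp_le:
  fixes K :: nat
  assumes "\<And>e. e \<ge> 1 \<Longrightarrow> e ^ c \<le> K * e ^ s"
  shows "c \<le> s"
proof (rule ccontr)
  assume "\<not> c \<le> s"
  define e where "e = Suc K"
  have "e ^ Suc s \<le> e ^ c"
    by (rule power_increasing) (use \<open>\<not> c \<le> s\<close> in \<open>auto simp: e_def\<close>)
  also have "\<dots> \<le> K * e ^ s" by (rule assms) (simp add: e_def)
  also have "\<dots> < e * e ^ s" by (simp add: e_def)
  finally show False by simp
qed


section \<open>An upper bound for the arithmetical rank\<close>

text \<open>
  This is the criterion of Schmitt and Vogel for squarefree monomials, where divisibility becomes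
  inclusion of supports. The level \<open>L k\<close> contributes the single equation given by the sum of its
  monomials, and induction on \<open>k\<close> puts each of these monomials into the radical.
\<close>

lemma ara_sqfree_ideal_le:
  fixes H :: "'v set set" and L :: "nat \<Rightarrow> 'v set set"
  assumes "finite V" and H: "\<And>G. G \<in> H \<Longrightarrow> G \<subseteq> V"
    and L: "\<And>k W. k < N \<Longrightarrow> W \<in> L k \<Longrightarrow> W \<subseteq> V \<and> (\<exists>G\<in>H. G \<subseteq> W)"
    and below: "\<And>G. G \<in> H \<Longrightarrow> \<exists>k<N. \<exists>W\<in>L k. W \<subseteq> G"
    and union: "\<And>k W W'. k < N \<Longrightarrow> W \<in> L k \<Longrightarrow> W' \<in> L k \<Longrightarrow> W \<noteq> W' \<Longrightarrow>
      \<exists>k'<k. \<exists>W''\<in>L k'. W'' \<subseteq> W \<union> W'"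
  shows "ara (mpoly_ring V) (Idl\<^bsub>mpoly_ring V\<^esub>
    (sqfree_monomial ` H :: ('v, 'k::field) mpolynomial set)) \<le> enat N"
proof -
  let ?R = "mpoly_ring V :: ('v, 'k) mpolynomial ring"
  let ?m = "sqfree_monomial :: 'v set \<Rightarrow> ('v, 'k) mpolynomial"
  interpret R: ring ?R by (rule ring_mpoly_ring)
  define q where "q i = (\<Sum>W\<in>L (i - 1). ?m W)" for i
  define J where "J = Idl\<^bsub>?R\<^esub> (q ` {1..N})"
  define I where "I = Idl\<^bsub>?R\<^esub> (?m ` H)"
  have vars: "mpoly_vars (?m W) \<subseteq> V" if "W \<subseteq> V" for W
    using mpoly_vars_sqfree_monomial[of W] that finite_subset[OF that assms(1)] by blast
  have fin: "finite W" if "W \<subseteq> V" for W using that assms(1) finite_subset by blast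
  have qV: "mpoly_vars (q i) \<subseteq> V" if i: "i \<in> {1..N}" for i
  proof -
    have "i - 1 < N" using i by auto
    then show ?thesis unfolding q_def by (intro mpoly_vars_sumI vars) (use L in blast)
  qed
  then have qR: "q ` {1..N} \<subseteq> carrier ?R" by (intro image_subsetI) simp
  then have J: "ideal J ?R" unfolding J_def by (rule R.genideal_ideal)
  have Rad: "ideal (radical ?R J) ?R" by (rule ideal_radical[OF J])
  have "?m ` H \<subseteq> carrier ?R" using vars H by auto
  then have I: "ideal I ?R" and HI: "?m ` H \<subseteq> I"
    unfolding I_def by (rule R.genideal_ideal, rule R.genideal_self)
  have up: "?m W' \<in> K" if K: "ideal K ?R" and "?m W \<in> K" "W \<subseteq> W'" "W' \<subseteq> V" for K W W'
  proof -
    have "?m W' = ?m (W' - W) * ?m W"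
      using sqfree_monomial_subset[OF fin that(3)] that(4) by simp
    then show ?thesis using ideal_mpoly_mult[OF K that(2) vars[of "W' - W"]] that(4) by auto
  qed
  \<comment> \<open>The product of an equation and one of its monomials is the square of this monomial plus
    products that lie in the radical by induction.\<close>
  have level: "?m W \<in> radical ?R J" if "k < N" "W \<in> L k" for k W
    using that
  proof (induction k arbitrary: W rule: less_induct)
    case (less k)
    have WV: "W \<subseteq> V" using less.prems L by blast
    have "finite (L k)"
      using finite_subset[of "L k" "Pow V"] L[OF less.prems(1)] assms(1) by auto
    have "?m W * ?m W' \<in> radical ?R J" if W': "W' \<in> L k - {W}" for W'
    proof -
      obtain k' W'' where "k' < k" "W'' \<in> L k'" and sub: "W'' \<subseteq> W \<union> W'"
        using union[OF less.prems, of W'] W' by blast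
      have "?m W'' \<in> radical ?R J"
        using less.IH[OF \<open>k' < k\<close> _ \<open>W'' \<in> L k'\<close>] \<open>k' < k\<close> less.prems by simp
      moreover have W'V: "W' \<subseteq> V" using W' less.prems L by blast
      ultimately have "?m (W \<union> W') \<in> radical ?R J" using up[OF Rad _ sub] WV by blast
      then show ?thesis
        unfolding sqfree_monomial_mult_eq[OF fin[OF WV] fin[OF W'V]]
        by (subst mult.commute) (rule ideal_mpoly_mult[OF Rad _ vars], assumption, use WV in blast)
    qed
    then have "(\<Sum>W'\<in>L k - {W}. ?m W * ?m W') \<in> radical ?R J"
      by (rule ideal_mpoly_sum[OF Rad])
    moreover have "?m W * q (Suc k) \<in> radical ?R J"
    proof (rule ideal_mpoly_mult[OF Rad _ vars[OF WV]])
      have "q (Suc k) \<in> J"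
        unfolding J_def by (rule subsetD[OF R.genideal_self[OF qR]]) (use less.prems in auto)
      then show "q (Suc k) \<in> radical ?R J" using subset_radical[OF J] by blast
    qed
    ultimately have "?m W * q (Suc k) - (\<Sum>W'\<in>L k - {W}. ?m W * ?m W') \<in> radical ?R J"
      using ideal_mpoly_diff[OF Rad] by blast
    also have "?m W * q (Suc k) - (\<Sum>W'\<in>L k - {W}. ?m W * ?m W') = ?m W ^ 2"
      using less.prems \<open>finite (L k)\<close>
      by (simp add: q_def sum.remove[of "L k" W] distrib_left power2_eq_square
        flip: sum_distrib_left)
    finally show ?case using radical_power_cancel[of "?m W" 2 V J] vars[OF WV] by simp
  qed
  have "?m ` H \<subseteq> radical ?R J"
  proof (rule image_subsetI)
    fix G assume G: "G \<in> H"
    then obtain k W where "k < N" "W \<in> L k" "W \<subseteq> G" using below by blast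
    then show "?m G \<in> radical ?R J" using up[OF Rad level[of k W]] H[OF G] by blast
  qed
  then have "I \<subseteq> radical ?R J" unfolding I_def by (rule R.genideal_minimal[OF Rad])
  moreover have "J \<subseteq> radical ?R I"
  proof -
    have "q i \<in> I" if i: "i \<in> {1..N}" for i
      unfolding q_def
    proof (rule ideal_mpoly_sum[OF I])
      fix W assume W: "W \<in> L (i - 1)"
      have "i - 1 < N" using i by auto
      then obtain G where "G \<in> H" "G \<subseteq> W" "W \<subseteq> V" using L[OF _ W] by blast
      then show "?m W \<in> I" using up[OF I, of G W] HI by blast
    qed
    then have "J \<subseteq> I" unfolding J_def by (intro R.genideal_minimal[OF I] image_subsetI)
    then show ?thesis using subset_radical[OF I] by blast
  qed
  ultimately have "radical ?R J = radical ?R I" using radical_subset by blast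
  then have "\<exists>a. (\<forall>i\<in>{1..N}. a i \<in> carrier ?R) \<and> radical ?R (Idl\<^bsub>?R\<^esub> (a ` {1..N})) = radical ?R I"
    using qV by (intro exI[of _ q]) (simp add: J_def)
  then show ?thesis unfolding ara_def I_def[symmetric] by (intro Inf_lower) blast
qed


section \<open>Minimal primes of squarefree monomial ideals\<close>

text \<open>
  Minimality is expressed by private edges: \<open>v\<close> can be dropped from the cover \<open>C\<close> exactly if there
  is no edge that \<open>C\<close> meets in \<open>v\<close> only.
\<close>

definition minimal_vertex_cover :: "'v set \<Rightarrow> 'v set set \<Rightarrow> 'v set \<Rightarrow> bool" where
  "minimal_vertex_cover V H C \<longleftrightarrow>
     C \<subseteq> V \<and> (\<forall>G\<in>H. G \<inter> C \<noteq> {}) \<and> (\<forall>v\<in>C. \<exists>G\<in>H. G \<inter> C = {v})"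

lemma sqfree_ideal_subset_coordinate_prime_iff:
  fixes H :: "'v set set"
  assumes "finite V" and H: "\<And>G. G \<in> H \<Longrightarrow> G \<subseteq> V"
  shows "Idl\<^bsub>mpoly_ring V\<^esub> (sqfree_monomial ` H :: ('v, 'k::field) mpolynomial set)
      \<subseteq> coordinate_prime V C \<longleftrightarrow> (\<forall>G\<in>H. G \<inter> C \<noteq> {})"
proof -
  let ?m = "sqfree_monomial :: 'v set \<Rightarrow> ('v, 'k) mpolynomial"
  have iff: "?m G \<in> coordinate_prime V C \<longleftrightarrow> G \<inter> C \<noteq> {}" if "G \<in> H" for G
    using sqfree_monomial_in_coordinate_prime_iff H[OF that] finite_subset assms(1) by metis
  have "?m ` H \<subseteq> carrier (mpoly_ring V)"
  proof (rule image_subsetI)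
    fix G assume "G \<in> H"
    then show "?m G \<in> carrier (mpoly_ring V)"
      using mpoly_vars_sqfree_monomial[of G] H finite_subset[OF H assms(1)] by force
  qed
  then have "?m ` H \<subseteq> Idl\<^bsub>mpoly_ring V\<^esub> (?m ` H)"
    by (rule ring.genideal_self[OF ring_mpoly_ring])
  then show ?thesis
    using iff ring.genideal_minimal[OF ring_mpoly_ring
      ideal_coordinate_prime, of "?m ` H" V C]
    by blast
qed

text \<open>
  A prime that contains a squarefree monomial contains one of its variables. Hence the variables in
  a prime over the ideal form a cover, and the prime contains the coordinate prime of this cover.
\<close>

lemma minimal_primes_sqfree_ideal:
  fixes H :: "'v set set"
  assumes "finite V" and H: "\<And>G. G \<in> H \<Longrightarrow> G \<subseteq> V"
  shows "minimal_primes (mpoly_ring V)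
      (Idl\<^bsub>mpoly_ring V\<^esub> (sqfree_monomial ` H :: ('v, 'k::field) mpolynomial set)) =
    coordinate_prime V ` {C. minimal_vertex_cover V H C}"
proof -
  let ?R = "mpoly_ring V :: ('v, 'k) mpolynomial ring"
  let ?m = "sqfree_monomial :: 'v set \<Rightarrow> ('v, 'k) mpolynomial"
  define I where "I = Idl\<^bsub>?R\<^esub> (?m ` H)"
  interpret R: ring ?R by (rule ring_mpoly_ring)
  have fin: "finite G" if "G \<in> H" for G using H[OF that] assms(1) finite_subset by blast
  have "?m ` H \<subseteq> carrier ?R"
    using mpoly_vars_sqfree_monomial[OF fin] H by fastforce
  then have mI: "?m G \<in> I" if "G \<in> H" for G
    using R.genideal_self that unfolding I_def by blast
  have meets: "\<exists>v\<in>G. mpoly_var v \<in> P" if "primeideal P ?R" "I \<subseteq> P" "G \<in> H" for P G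
    using primeideal_sqfree_monomial[OF that(1) fin[OF that(3)] H[OF that(3)]] mI[OF that(3)] that(2)
    by blast
  have var_iff: "mpoly_var v \<in> (coordinate_prime V C :: ('v, 'k) mpolynomial set) \<longleftrightarrow> v \<in> C"
    if "v \<in> V"
    for v C using that
    by (simp add: mpoly_var_eq_sqfree_monomial sqfree_monomial_in_coordinate_prime_iff)
  have I_iff: "I \<subseteq> coordinate_prime V C \<longleftrightarrow> (\<forall>G\<in>H. G \<inter> C \<noteq> {})" for C
    unfolding I_def by (rule sqfree_ideal_subset_coordinate_prime_iff[OF assms])
  show ?thesis unfolding I_def[symmetric]
  proof (intro equalityI subsetI)
    fix P assume "P \<in> minimal_primes ?R I"
    then have P: "primeideal P ?R" "I \<subseteq> P"
      and least: "\<And>Q. primeideal Q ?R \<Longrightarrow> I \<subseteq> Q \<Longrightarrow> Q \<subseteq> P \<Longrightarrow> Q = P"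
      by (auto simp: minimal_primes_def)
    define C where "C = {v \<in> V. mpoly_var v \<in> P}"
    have cover: "\<forall>G\<in>H. G \<inter> C \<noteq> {}" using meets[OF P] H by (fastforce simp: C_def)
    have "coordinate_prime V C \<subseteq> P"
      by (rule coordinate_prime_least[OF primeideal_mpoly_ideal[OF P(1)]]) (simp add: C_def)
    then have P_eq: "P = coordinate_prime V C"
      using least[OF primeideal_coordinate_prime, of C] cover I_iff by blast
    \<comment> \<open>Without a private edge of \<open>v\<close>, the cover \<open>C - {v}\<close> would give a smaller prime.\<close>
    have "\<exists>G\<in>H. G \<inter> C = {v}" if v: "v \<in> C" for v
    proof (rule ccontr)
      assume "\<not> ?thesis"
      then have "\<forall>G\<in>H. G \<inter> (C - {v}) \<noteq> {}" using cover by blast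
      then have "coordinate_prime V (C - {v}) = P"
        using least[OF primeideal_coordinate_prime, of "C - {v}"] I_iff P_eq
          coordinate_prime_mono[of "C - {v}" C V] by blast
      then have "mpoly_var v \<in> (coordinate_prime V (C - {v}) :: ('v, 'k) mpolynomial set)"
        using v by (simp add: C_def)
      then show False using v var_iff[of v "C - {v}"] by (simp add: C_def)
    qed
    moreover have "C \<subseteq> V" by (auto simp: C_def)
    ultimately have "minimal_vertex_cover V H C" using cover by (simp add: minimal_vertex_cover_def)
    then show "P \<in> coordinate_prime V ` {C. minimal_vertex_cover V H C}"
      using P_eq by blast
  next
    fix P :: "('v, 'k) mpolynomial set"
    assume "P \<in> coordinate_prime V ` {C. minimal_vertex_cover V H C}"
    then obtain C where P: "P = coordinate_prime V C" and C: "C \<subseteq> V"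
      "\<forall>G\<in>H. G \<inter> C \<noteq> {}" "\<forall>v\<in>C. \<exists>G\<in>H. G \<inter> C = {v}"
      by (auto simp: minimal_vertex_cover_def)
    have "Q = P" if Q: "primeideal Q ?R" "I \<subseteq> Q" "Q \<subseteq> P" for Q
    proof -
      have "mpoly_var v \<in> Q" if v: "v \<in> C" for v
      proof -
        obtain G where G: "G \<in> H" "G \<inter> C = {v}" using C(3) v by blast
        obtain u where u: "u \<in> G" "mpoly_var u \<in> Q" using meets[OF Q(1,2) G(1)] by blast
        then have "u \<in> C" using var_iff[of u C] Q(3) H[OF G(1)] unfolding P by blast
        then have "u = v" using u(1) G(2) by blast
        then show ?thesis using u(2) by simp
      qed
      then have "P \<subseteq> Q"
        unfolding P by (rule coordinate_prime_least[OF primeideal_mpoly_ideal[OF Q(1)]])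
      then show ?thesis using Q(3) by blast
    qed
    then show "P \<in> minimal_primes ?R I"
      using I_iff[of C] C(2) primeideal_coordinate_prime by (auto simp: minimal_primes_def P)
  qed
qed


section \<open>Heights of coordinate primes\<close>

text \<open>
  Elements picked from the successive steps of a chain of primes are algebraically independent over
  the field. Given a relation, cancel the smallest power of \<open>f j\<close>, which is not in \<open>P j\<close>; modulo
  \<open>P (Suc j)\<close> the remaining terms that contain \<open>f j\<close> vanish, and a relation among the later elements
  is left. The lexicographically smallest term survives to the end as a nonzero constant.
\<close>

lemma no_relation_along_prime_chain:
  fixes P :: "nat \<Rightarrow> ('v, 'k::field) mpolynomial set" and f :: "nat \<Rightarrow> ('v, 'k) mpolynomial"
  assumes prime: "\<And>i. i \<le> h \<Longrightarrow> primeideal (P i) (mpoly_ring V)"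
    and f: "\<And>i. i < h \<Longrightarrow> f i \<in> P (Suc i) - P i"
    and mono: "\<And>i. i < h \<Longrightarrow> P i \<subseteq> P (Suc i)"
    and "j \<le> h" "finite A" "A \<noteq> {}" "\<And>\<alpha>. \<alpha> \<in> A \<Longrightarrow> k \<alpha> \<noteq> 0"
    and "\<And>\<alpha> \<beta> i. \<alpha> \<in> A \<Longrightarrow> \<beta> \<in> A \<Longrightarrow> i < j \<or> h \<le> i \<Longrightarrow> \<alpha> i = \<beta> i"
    and "(\<Sum>\<alpha>\<in>A. mpoly_const (k \<alpha>) * (\<Prod>i\<in>{j..<h}. f i ^ \<alpha> i)) \<in> P j"
  shows False
  using assms(4-)
proof (induction j arbitrary: A rule: inc_induct)
  case base
  obtain \<alpha> where \<alpha>: "\<alpha> \<in> A" using base by blast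
  have "\<beta> = \<alpha>" if "\<beta> \<in> A" for \<beta>
    using base.prems(4)[OF that \<alpha>] by (intro ext) (metis not_le)
  then have "A = {\<alpha>}" using \<alpha> by blast
  then have "mpoly_const (k \<alpha>) \<in> P h" using base by simp
  then have "mpoly_const (1 / k \<alpha>) * mpoly_const (k \<alpha>) \<in> P h"
    using mpoly_vars_single[of 0 "1 / k \<alpha>"]
    by (intro ideal_mpoly_mult[OF primeideal_mpoly_ideal[OF prime]]) auto
  moreover have "mpoly_const (1 / k \<alpha>) * mpoly_const (k \<alpha>) = (1 :: ('v, 'k) mpolynomial)"
    using base.prems(3)[OF \<alpha>] by (simp add: mult_single)
  ultimately show False using primeideal_mpoly_one[OF prime, of h] by simp
next
  case (step j)
  note Pj = prime[OF less_imp_le[OF step.hyps(2)]]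
  have "Suc j \<le> h" using step.hyps by simp
  note PS = primeideal_mpoly_ideal[OF prime[OF this]]
  have fV: "mpoly_vars (f i) \<subseteq> V" if "i < h" for i
    using ideal_mpoly_vars[OF primeideal_mpoly_ideal[OF prime[of "Suc i"]], of "f i"] f[OF that] that
    by auto
  define d where "d = Min ((\<lambda>\<alpha>. \<alpha> j) ` A)"
  have d: "d \<le> \<alpha> j" if "\<alpha> \<in> A" for \<alpha> unfolding d_def using that step.prems by simp
  have "d \<in> (\<lambda>\<alpha>. \<alpha> j) ` A" unfolding d_def using step.prems by (intro Min_in) auto
  \<comment> \<open>The terms that are not multiples of \<open>f j\<close> once the factor \<open>f j ^ d\<close> is cancelled.\<close>
  define A' where "A' = {\<alpha> \<in> A. \<alpha> j = d}"
  have A': "finite A'" "A' \<noteq> {}" "A' \<subseteq> A"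
    using step.prems \<open>d \<in> _\<close> by (auto simp: A'_def)
  define g where "g \<alpha> = mpoly_const (k \<alpha>) * (\<Prod>i\<in>{Suc j..<h}. f i ^ \<alpha> i)" for \<alpha>
  have gV: "mpoly_vars (g \<alpha>) \<subseteq> V" for \<alpha>
    unfolding g_def using mpoly_vars_single[of 0 "k \<alpha>"]
    by (intro mpoly_vars_multI mpoly_vars_prodI mpoly_vars_powerI fV) auto
  define s where "s = (\<Sum>\<alpha>\<in>A. f j ^ (\<alpha> j - d) * g \<alpha>)"
  have "(\<Sum>\<alpha>\<in>A. mpoly_const (k \<alpha>) * (\<Prod>i\<in>{j..<h}. f i ^ \<alpha> i)) = f j ^ d * s"
    unfolding s_def sum_distrib_left
  proof (rule sum.cong)
    fix \<alpha> assume "\<alpha> \<in> A"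
    then have "f j ^ \<alpha> j = f j ^ d * f j ^ (\<alpha> j - d)" using d by (simp flip: power_add)
    then show "mpoly_const (k \<alpha>) * (\<Prod>i\<in>{j..<h}. f i ^ \<alpha> i) = f j ^ d * (f j ^ (\<alpha> j - d) * g \<alpha>)"
      using step.hyps by (simp add: g_def prod.atLeast_Suc_lessThan mult_ac)
  qed simp
  then have "f j ^ d * s \<in> P j" using step.prems(5) by simp
  moreover have "f j ^ d \<notin> P j"
    using primeideal_mpoly_power[OF Pj fV[OF step.hyps(2)]] f[OF step.hyps(2)] by blast
  moreover have "mpoly_vars s \<subseteq> V"
    unfolding s_def by (intro mpoly_vars_sumI mpoly_vars_multI mpoly_vars_powerI fV gV step.hyps)
  ultimately have "s \<in> P j"
    using primeideal_mpoly_prime[OF Pj mpoly_vars_powerI[OF fV[OF step.hyps(2)]]] by blast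
  then have "s \<in> P (Suc j)" using mono[OF step.hyps(2)] by blast
  moreover have "(\<Sum>\<alpha>\<in>A - A'. f j ^ (\<alpha> j - d) * g \<alpha>) \<in> P (Suc j)"
  proof (rule ideal_mpoly_sum[OF PS])
    fix \<alpha> assume "\<alpha> \<in> A - A'"
    then obtain l where l: "\<alpha> j - d = Suc l"
      using d[of \<alpha>] by (cases "\<alpha> j - d") (auto simp: A'_def)
    then have "f j ^ (\<alpha> j - d) * g \<alpha> = (f j ^ l * g \<alpha>) * f j"
      by (simp add: mult_ac)
    moreover have "(f j ^ l * g \<alpha>) * f j \<in> P (Suc j)"
      using f[OF step.hyps(2)]
      by (intro ideal_mpoly_mult[OF PS] mpoly_vars_multI mpoly_vars_powerI fV gV step.hyps) auto
    ultimately show "f j ^ (\<alpha> j - d) * g \<alpha> \<in> P (Suc j)" by simp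
  qed
  ultimately have "s - (\<Sum>\<alpha>\<in>A - A'. f j ^ (\<alpha> j - d) * g \<alpha>) \<in> P (Suc j)"
    by (rule ideal_mpoly_diff[OF PS])
  also have "s = (\<Sum>\<alpha>\<in>A - A'. f j ^ (\<alpha> j - d) * g \<alpha>) + (\<Sum>\<alpha>\<in>A'. f j ^ (\<alpha> j - d) * g \<alpha>)"
    unfolding s_def by (rule sum.subset_diff[OF A'(3) step.prems(1)])
  also have "(\<Sum>\<alpha>\<in>A'. f j ^ (\<alpha> j - d) * g \<alpha>) = (\<Sum>\<alpha>\<in>A'. g \<alpha>)"
    by (intro sum.cong) (auto simp: A'_def)
  finally have "(\<Sum>\<alpha>\<in>A'. g \<alpha>) \<in> P (Suc j)" by simp
  then show False
    unfolding g_def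
  proof (rule step.IH[OF A'(1,2), rotated 2])
    show "k \<alpha> \<noteq> 0" if "\<alpha> \<in> A'" for \<alpha> using that A' step.prems by blast
    show "\<alpha> i = \<beta> i" if "\<alpha> \<in> A'" "\<beta> \<in> A'" "i < Suc j \<or> h \<le> i" for \<alpha> \<beta> i
      using that A' step.prems(4)[of \<alpha> \<beta> i] by (cases "i = j") (auto simp: A'_def)
  qed
qed

definition exponents_le :: "nat \<Rightarrow> ('v, 'k::field) mpolynomial \<Rightarrow> bool" where
  "exponents_le d p \<longleftrightarrow> (\<forall>t\<in>Poly_Mapping.keys p. \<forall>v. Poly_Mapping.lookup t v \<le> d)"

lemma exponents_le_mult:
  assumes "exponents_le d p" "exponents_le e q"
  shows "exponents_le (d + e) (p * q)"
  unfolding exponents_le_def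
proof (intro ballI allI)
  fix t v assume "t \<in> Poly_Mapping.keys (p * q)"
  then obtain a b where "t = a + b" "a \<in> Poly_Mapping.keys p" "b \<in> Poly_Mapping.keys q"
    using keys_mult[of p q] by blast
  then show "Poly_Mapping.lookup t v \<le> d + e"
    using assms by (simp add: exponents_le_def lookup_add add_mono)
qed

lemma exponents_le_power: "exponents_le d p \<Longrightarrow> exponents_le (n * d) (p ^ n)"
proof (induction n)
  case (Suc n)
  then show ?case using exponents_le_mult[of d p "n * d" "p ^ n"] by simp
qed (simp add: exponents_le_def)

lemma exponents_le_prod:
  "(\<And>i. i \<in> A \<Longrightarrow> exponents_le (d i) (f i)) \<Longrightarrow> exponents_le (\<Sum>i\<in>A. d i) (\<Prod>i\<in>A. f i)"
proof (induction A rule: infinite_finite_induct)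
  case (insert i A)
  then show ?case using exponents_le_mult[of "d i" "f i" "sum d A" "prod f A"] by simp
qed (simp_all add: exponents_le_def)

lemma exponents_le_exists: "\<exists>d. exponents_le d p"
proof -
  define S where "S = (\<Union>t\<in>Poly_Mapping.keys p. Poly_Mapping.lookup t ` Poly_Mapping.keys t)"
  have "finite S" by (simp add: S_def)
  have "Poly_Mapping.lookup t v \<le> Max (insert 0 S)" if "t \<in> Poly_Mapping.keys p" for t v
  proof (cases "v \<in> Poly_Mapping.keys t")
    case True
    then have "Poly_Mapping.lookup t v \<in> insert 0 S" using that by (auto simp: S_def)
    then show ?thesis using \<open>finite S\<close> by (intro Max_ge) auto
  qed (simp add: in_keys_iff)
  then show ?thesis by (auto simp: exponents_le_def)
qed

text \<open>
  Along a chain of length \<open>h\<close> pick \<open>f i \<in> P (Suc i) - P i\<close>. The \<open>e ^ h\<close> power products of the \<open>f i\<close>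
  with exponents below \<open>e\<close> lie in the span of a box of monomials with at most a constant multiple of
  \<open>e ^ card V\<close> elements. If \<open>h > card V\<close>, they are linearly dependent for large \<open>e\<close>, against the
  algebraic independence of the \<open>f i\<close>.
\<close>

lemma prime_chain_length_le:
  fixes P :: "nat \<Rightarrow> ('v, 'k::field) mpolynomial set"
  assumes "finite V" and prime: "\<And>i. i \<le> h \<Longrightarrow> primeideal (P i) (mpoly_ring V)"
    and strict: "\<And>i. i < h \<Longrightarrow> P i \<subset> P (Suc i)"
  shows "h \<le> card V"
proof -
  have "\<forall>i. \<exists>p. i < h \<longrightarrow> p \<in> P (Suc i) - P i" using strict by blast
  then obtain f where f: "\<And>i. i < h \<Longrightarrow> f i \<in> P (Suc i) - P i" by metis
  have fV: "mpoly_vars (f i) \<subseteq> V" if "i < h" for i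
    using ideal_mpoly_vars[OF primeideal_mpoly_ideal[OF prime[of "Suc i"]], of "f i"] f[OF that] that
    by auto
  have "\<forall>i. \<exists>d. exponents_le d (f i)" by (intro allI exponents_le_exists)
  then obtain d where d: "\<And>i. exponents_le (d i) (f i)" by metis
  define D where "D = (\<Sum>i<h. d i)"
  define m where "m \<alpha> = (\<Prod>i\<in>{0..<h}. f i ^ \<alpha> i)" for \<alpha> :: "nat \<Rightarrow> nat"
  have "e ^ h \<le> (D + 1) ^ card V * e ^ card V" if e: "e \<ge> 1" for e
  proof (rule ccontr)
    assume less: "\<not> ?thesis"
    define A where "A = {..<h} \<rightarrow>\<^sub>E {..<e}"
    \<comment> \<open>A power product with exponents below \<open>e\<close> has exponents at most \<open>D * e\<close> in every variable.\<close>
    define B where "B = exponent_box V ((D + 1) * e)"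
    have "finite A" "finite B"
      using assms(1) by (auto simp: A_def B_def finite_exponent_box intro!: finite_PiE)
    have keys: "Poly_Mapping.keys (m \<alpha>) \<subseteq> B" if \<alpha>: "\<alpha> \<in> A" for \<alpha>
    proof
      fix t assume t: "t \<in> Poly_Mapping.keys (m \<alpha>)"
      have "mpoly_vars (m \<alpha>) \<subseteq> V"
        unfolding m_def by (intro mpoly_vars_prodI mpoly_vars_powerI fV) auto
      moreover have "exponents_le (\<Sum>i\<in>{0..<h}. \<alpha> i * d i) (m \<alpha>)"
        unfolding m_def by (intro exponents_le_prod exponents_le_power d)
      moreover have "(\<Sum>i\<in>{0..<h}. \<alpha> i * d i) \<le> (\<Sum>i\<in>{0..<h}. e * d i)"
        by (intro sum_mono mult_right_mono) (use \<alpha> in \<open>auto simp: A_def PiE_iff less_imp_le\<close>)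
      moreover have "(\<Sum>i\<in>{0..<h}. e * d i) < (D + 1) * e"
        using e by (simp add: D_def sum_distrib_left[symmetric] lessThan_atLeast0 mult.commute)
      ultimately show "t \<in> B"
        using t unfolding B_def exponent_box_def exponents_le_def mpoly_vars_def
        by (fastforce intro: le_less_trans)
    qed
    have "card B < card A"
      using less assms(1) by (simp add: A_def B_def card_exponent_box card_PiE flip: power_mult_distrib)
    from underdetermined_system_solvable[OF \<open>finite B\<close> \<open>finite A\<close> this,
        of "\<lambda>\<alpha> t. Poly_Mapping.lookup (m \<alpha>) t"]
    obtain k where k: "\<exists>\<alpha>\<in>A. k \<alpha> \<noteq> 0"
      "\<And>t. t \<in> B \<Longrightarrow> (\<Sum>\<alpha>\<in>A. k \<alpha> * Poly_Mapping.lookup (m \<alpha>) t) = 0" by blast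
    have "(\<Sum>\<alpha>\<in>A. mpoly_const (k \<alpha>) * m \<alpha>) = 0"
    proof (rule poly_mapping_eqI)
      fix t
      have "(\<Sum>\<alpha>\<in>A. k \<alpha> * Poly_Mapping.lookup (m \<alpha>) t) = 0"
      proof (cases "t \<in> B")
        case False
        then have "Poly_Mapping.lookup (m \<alpha>) t = 0" if "\<alpha> \<in> A" for \<alpha>
          using keys[OF that] by (auto simp: in_keys_iff)
        then show ?thesis by simp
      qed (rule k(2))
      then show "Poly_Mapping.lookup (\<Sum>\<alpha>\<in>A. mpoly_const (k \<alpha>) * m \<alpha>) t = Poly_Mapping.lookup 0 t"
        by (simp add: lookup_sum lookup_const_mult)
    qed
    moreover have "(\<Sum>\<alpha>\<in>A. mpoly_const (k \<alpha>) * m \<alpha>) = (\<Sum>\<alpha>\<in>{\<alpha> \<in> A. k \<alpha> \<noteq> 0}. mpoly_const (k \<alpha>) * m \<alpha>)"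
      using \<open>finite A\<close> by (intro sum.mono_neutral_right) auto
    ultimately have "(\<Sum>\<alpha>\<in>{\<alpha> \<in> A. k \<alpha> \<noteq> 0}. mpoly_const (k \<alpha>) * m \<alpha>) \<in> P 0"
      using ideal_mpoly_zero[OF primeideal_mpoly_ideal[OF prime[of 0]]] by simp
    then have rel: "(\<Sum>\<alpha>\<in>{\<alpha> \<in> A. k \<alpha> \<noteq> 0}. mpoly_const (k \<alpha>) * (\<Prod>i\<in>{0..<h}. f i ^ \<alpha> i)) \<in> P 0"
      by (simp only: m_def)
    show False
    proof (rule no_relation_along_prime_chain[where P = P and j = 0, OF prime f _ _ _ _ _ _ rel])
      show "P i \<subseteq> P (Suc i)" if "i < h" for i using strict[OF that] by blast
      show "\<alpha> i = \<beta> i" if "\<alpha> \<in> {\<alpha> \<in> A. k \<alpha> \<noteq> 0}" "\<beta> \<in> {\<alpha> \<in> A. k \<alpha> \<noteq> 0}" "i < 0 \<or> h \<le> i" for \<alpha> \<beta> i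
        using that by (auto simp: A_def PiE_def extensional_def)
    qed (use k(1) \<open>finite A\<close> in auto)
  qed
  then show ?thesis by (rule power_bound_imp_le)
qed

lemma coordinate_prime_chain:
  assumes "finite V" "C \<subseteq> D" "D \<subseteq> V"
  obtains E :: "nat \<Rightarrow> ('v, 'k::field) mpolynomial set"
  where "\<And>i. primeideal (E i) (mpoly_ring V)" "E 0 = coordinate_prime V C"
    "E (card (D - C)) = coordinate_prime V D" "\<And>i. i < card (D - C) \<Longrightarrow> E i \<subset> E (Suc i)"
proof -
  have "finite (D - C)" using assms finite_subset by blast
  then obtain g where g: "bij_betw g {0..<card (D - C)} (D - C)"
    using ex_bij_betw_nat_finite by blast
  define E :: "nat \<Rightarrow> ('v, 'k) mpolynomial set"
    where "E i = coordinate_prime V (C \<union> g ` {0..<i})" for i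
  have "E i \<subset> E (Suc i)" if i: "i < card (D - C)" for i
    unfolding E_def
  proof (rule coordinate_prime_strict)
    have "g i \<in> D - C" using g i by (auto simp: bij_betw_def)
    moreover have "g i \<notin> g ` {0..<i}"
    proof
      assume "g i \<in> g ` {0..<i}"
      then obtain j where "j < i" "g i = g j" by auto
      then show False
        using inj_onD[OF bij_betw_imp_inj_on[OF g], of i j] i by simp
    qed
    ultimately show "C \<union> g ` {0..<i} \<subset> C \<union> g ` {0..<Suc i}" by (auto simp: psubset_eq)
    show "C \<union> g ` {0..<Suc i} \<subseteq> V" using g i assms by (fastforce simp: bij_betw_def)
  qed
  moreover have "C \<union> g ` {0..<card (D - C)} = D" using g assms by (auto simp: bij_betw_def)
  ultimately show thesis
    by (intro that[of E]) (auto simp: E_def primeideal_coordinate_prime)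
qed

text \<open>
  Adding the variables of \<open>C\<close> one at a time gives a chain of length \<open>card C\<close>. Conversely, any chain
  that ends in the prime of \<open>C\<close> extends by the \<open>card (V - C)\<close> remaining variables to a chain that
  ends in the prime of \<open>V\<close>, and its total length is at most \<open>card V\<close>.
\<close>

lemma prime_height_coordinate_prime:
  assumes "finite V" "C \<subseteq> V"
  shows "prime_height (mpoly_ring V) (coordinate_prime V C :: ('v, 'k::field) mpolynomial set) =
    enat (card C)"
proof (rule antisym)
  show "prime_height (mpoly_ring V) (coordinate_prime V C :: ('v, 'k) mpolynomial set) \<le> enat (card C)"
    unfolding prime_height_def
  proof (rule Sup_least, clarify)
    fix h and P :: "nat \<Rightarrow> ('v, 'k) mpolynomial set"
    assume prime: "\<forall>i\<le>h. primeideal (P i) (mpoly_ring V)"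
      and strict: "\<forall>i<h. P i \<subset> P (Suc i)" and top: "P h = coordinate_prime V C"
    obtain E :: "nat \<Rightarrow> ('v, 'k) mpolynomial set"
      where E: "\<And>i. primeideal (E i) (mpoly_ring V)" "E 0 = coordinate_prime V C"
        "\<And>i. i < card (V - C) \<Longrightarrow> E i \<subset> E (Suc i)"
      using coordinate_prime_chain[OF assms order_refl] by metis
    define Q where "Q i = (if i \<le> h then P i else E (i - h))" for i
    have "h + card (V - C) \<le> card V"
    proof (rule prime_chain_length_le[OF assms(1)])
      show "primeideal (Q i) (mpoly_ring V)" for i using prime E by (simp add: Q_def)
      show "Q i \<subset> Q (Suc i)" if "i < h + card (V - C)" for i
      proof (cases "i < h")
        case True
        then show ?thesis using strict by (simp add: Q_def)
      next
        case False
        then have "Q i = E (i - h)" "Q (Suc i) = E (Suc (i - h))"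
          using top E(2) by (auto simp: Q_def Suc_diff_le)
        then show ?thesis using E(3)[of "i - h"] that False by simp
      qed
    qed
    then have "h \<le> card C"
      using assms card_Diff_subset[of C V] card_mono[of V C] finite_subset[of C V] by simp
    then show "enat h \<le> enat (card C)" by simp
  qed
next
  obtain E :: "nat \<Rightarrow> ('v, 'k) mpolynomial set"
    where E: "\<And>i. primeideal (E i) (mpoly_ring V)" "E (card C) = coordinate_prime V C"
      "\<And>i. i < card C \<Longrightarrow> E i \<subset> E (Suc i)"
    using coordinate_prime_chain[OF assms(1) empty_subsetI assms(2)] by (metis Diff_empty)
  then show "enat (card C) \<le> prime_height (mpoly_ring V) (coordinate_prime V C :: ('v, 'k) mpolynomial set)"
    unfolding prime_height_def by (intro Sup_upper CollectI exI[of _ "card C"] exI[of _ E]) auto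
qed


section \<open>The number of equations of the origin\<close>

text \<open>The order of vanishing is taken with respect to the variables \<open>C\<close>; for polynomials in these
  variables only, the condition says that \<open>p\<close> lies in the \<open>j\<close>-th power of the ideal of the
  origin.\<close>

definition vanishing_order_ge :: "'v set \<Rightarrow> nat \<Rightarrow> ('v, 'k::field) mpolynomial \<Rightarrow> bool" where
  "vanishing_order_ge C j p \<longleftrightarrow>
     (\<forall>t\<in>Poly_Mapping.keys p. j \<le> (\<Sum>v\<in>C. Poly_Mapping.lookup t v))"

definition span_mod_order ::
  "'v set \<Rightarrow> nat \<Rightarrow> ('v, 'k::field) mpolynomial set \<Rightarrow> ('v, 'k) mpolynomial \<Rightarrow> bool" where
  "span_mod_order C j T p \<longleftrightarrow> (\<exists>k. vanishing_order_ge C j (p - (\<Sum>z\<in>T. mpoly_const (k z) * z)))"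

lemma vanishing_order_ge_0 [simp]: "vanishing_order_ge C 0 p"
  and vanishing_order_ge_zero [simp]: "vanishing_order_ge C j 0"
  by (simp_all add: vanishing_order_ge_def)

lemma vanishing_order_ge_add:
  "vanishing_order_ge C j p \<Longrightarrow> vanishing_order_ge C j q \<Longrightarrow> vanishing_order_ge C j (p + q)"
  using Poly_Mapping.keys_add[of p q] by (auto simp: vanishing_order_ge_def)

lemma vanishing_order_ge_sum:
  "(\<And>i. i \<in> A \<Longrightarrow> vanishing_order_ge C j (f i)) \<Longrightarrow> vanishing_order_ge C j (\<Sum>i\<in>A. f i)"
  by (induction A rule: infinite_finite_induct) (simp_all add: vanishing_order_ge_add)

lemma vanishing_order_ge_mult:
  assumes "vanishing_order_ge C i p" "vanishing_order_ge C j q"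
  shows "vanishing_order_ge C (i + j) (p * q)"
  unfolding vanishing_order_ge_def
proof
  fix t assume "t \<in> Poly_Mapping.keys (p * q)"
  then obtain a b where "t = a + b" "a \<in> Poly_Mapping.keys p" "b \<in> Poly_Mapping.keys q"
    using keys_mult[of p q] by blast
  then show "i + j \<le> (\<Sum>v\<in>C. Poly_Mapping.lookup t v)"
    using assms by (auto simp: vanishing_order_ge_def lookup_add sum.distrib intro!: add_mono)
qed

lemma vanishing_order_ge_const_mult:
  "vanishing_order_ge C j p \<Longrightarrow> vanishing_order_ge C j (mpoly_const c * p)"
  using vanishing_order_ge_mult[of C 0 "mpoly_const c" j p] by simp

lemma span_mod_order_add:
  assumes "span_mod_order C j T p" "span_mod_order C j T q"
  shows "span_mod_order C j T (p + q)"
proof -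
  obtain k l where "vanishing_order_ge C j (p - (\<Sum>z\<in>T. mpoly_const (k z) * z))"
    "vanishing_order_ge C j (q - (\<Sum>z\<in>T. mpoly_const (l z) * z))"
    using assms by (auto simp: span_mod_order_def)
  from vanishing_order_ge_add[OF this]
  have "vanishing_order_ge C j (p + q - (\<Sum>z\<in>T. mpoly_const (k z + l z) * z))"
    by (simp add: single_add distrib_right sum.distrib algebra_simps)
  then show ?thesis unfolding span_mod_order_def by (rule exI[of _ "\<lambda>z. k z + l z"])
qed

lemma span_mod_order_of_order:
  "vanishing_order_ge C j p \<Longrightarrow> span_mod_order C j T p"
  unfolding span_mod_order_def by (rule exI[of _ "\<lambda>_. 0"]) simp

lemma span_mod_order_sum:
  "(\<And>i. i \<in> A \<Longrightarrow> span_mod_order C j T (f i)) \<Longrightarrow> span_mod_order C j T (\<Sum>i\<in>A. f i)"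
  by (induction A rule: infinite_finite_induct)
    (simp_all add: span_mod_order_add span_mod_order_of_order)

lemma span_mod_order_base:
  assumes "finite T" "z \<in> T"
  shows "span_mod_order C j T (mpoly_const c * z)"
  unfolding span_mod_order_def
proof (rule exI[of _ "\<lambda>y. if y = z then c else 0"])
  have "(\<Sum>y\<in>T. mpoly_const (if y = z then c else 0) * y) = mpoly_const c * z"
    using assms by (subst sum.remove[OF assms]) (simp add: sum.neutral)
  then show "vanishing_order_ge C j
      (mpoly_const c * z - (\<Sum>y\<in>T. mpoly_const (if y = z then c else 0) * y))"
    by simp
qed

text \<open>This step raises the order by one at the price of multiplying the spanning set by \<open>b\<close>.\<close>

lemma span_mod_order_mult:
  assumes "span_mod_order C j T p" "vanishing_order_ge C 1 b" "finite T'"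
    and T': "\<And>z. z \<in> T \<Longrightarrow> b * z \<in> T'"
  shows "span_mod_order C (Suc j) T' (b * p)"
proof -
  obtain k where "vanishing_order_ge C j (p - (\<Sum>z\<in>T. mpoly_const (k z) * z))"
    using assms(1) by (auto simp: span_mod_order_def)
  from vanishing_order_ge_mult[OF assms(2) this]
  have "span_mod_order C (Suc j) T' (b * (p - (\<Sum>z\<in>T. mpoly_const (k z) * z)))"
    by (intro span_mod_order_of_order) simp
  moreover have "span_mod_order C (Suc j) T' (\<Sum>z\<in>T. mpoly_const (k z) * (b * z))"
    by (intro span_mod_order_sum span_mod_order_base assms(3) T')
  ultimately have "span_mod_order C (Suc j) T' (b * (p - (\<Sum>z\<in>T. mpoly_const (k z) * z)) +
      (\<Sum>z\<in>T. mpoly_const (k z) * (b * z)))"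
    by (rule span_mod_order_add)
  also have "b * (p - (\<Sum>z\<in>T. mpoly_const (k z) * z)) + (\<Sum>z\<in>T. mpoly_const (k z) * (b * z)) = b * p"
    by (simp add: right_diff_distrib sum_distrib_left mult_ac)
  finally show ?thesis .
qed

text \<open>
  Suppose that \<open>b i\<close>, for \<open>i \<in> S\<close>, have no constant term and that their ideal contains powers of all
  variables. Modulo this ideal the polynomials are spanned by the finite box of monomials with
  exponents below some \<open>\<tau>\<close>. Expanding the coefficients of the \<open>b i\<close> repeatedly, one sees that modulo
  order \<open>j\<close> they are spanned by these monomials times the products of powers \<open>b i ^ \<gamma> i\<close> with
  \<open>\<gamma> i < j\<close>, that is by at most a constant times \<open>j ^ card S\<close> elements. On the other hand the
  \<open>e ^ card C\<close> monomials with exponents below \<open>e\<close> have degree less than \<open>j = card C * e\<close>, so they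
  are independent modulo order \<open>j\<close>. Letting \<open>e\<close> grow gives the inequality.
\<close>

lemma card_variables_le_card_equations:
  fixes b :: "'i \<Rightarrow> ('v, 'k::field) mpolynomial"
  assumes "finite C" "finite S"
    and b: "\<And>i. i \<in> S \<Longrightarrow> vanishing_order_ge C 1 (b i)"
    and pow: "\<And>v. v \<in> C \<Longrightarrow> \<exists>k g. (\<forall>i\<in>S. mpoly_vars (g i) \<subseteq> C) \<and> mpoly_var v ^ k = (\<Sum>i\<in>S. b i * g i)"
  shows "card C \<le> card S"
proof (cases "C = {}")
  case False
  have "\<forall>v. \<exists>k g. v \<in> C \<longrightarrow> (\<forall>i\<in>S. mpoly_vars (g i) \<subseteq> C) \<and> mpoly_var v ^ k = (\<Sum>i\<in>S. b i * g i)"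
    using pow by blast
  then obtain k g where g: "\<And>v i. v \<in> C \<Longrightarrow> i \<in> S \<Longrightarrow> mpoly_vars (g v i) \<subseteq> C"
    and k: "\<And>v. v \<in> C \<Longrightarrow> mpoly_var v ^ k v = (\<Sum>i\<in>S. b i * g v i)"
    by metis
  define \<tau> where "\<tau> = (\<Sum>v\<in>C. k v)"
  have \<tau>: "k v \<le> \<tau>" if "v \<in> C" for v
    unfolding \<tau>_def using assms(1) that by (intro member_le_sum) auto
  define T where "T j = (\<lambda>(\<beta>, \<gamma>). Poly_Mapping.single \<beta> 1 * (\<Prod>i\<in>S. b i ^ \<gamma> i)) `
    (exponent_box C \<tau> \<times> (S \<rightarrow>\<^sub>E {..<j}))" for j
  have finT: "finite (T j)" for j
    unfolding T_def using assms(1,2) by (intro finite_imageI finite_cartesian_product finite_PiE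
      finite_exponent_box) auto
  have cardT: "card (T j) \<le> \<tau> ^ card C * j ^ card S" for j
  proof -
    have "card (T j) \<le> card (exponent_box C \<tau> \<times> (S \<rightarrow>\<^sub>E {..<j}))"
      unfolding T_def using assms(1,2)
      by (intro card_image_le finite_cartesian_product finite_PiE finite_exponent_box) auto
    then show ?thesis
      using assms(1,2) by (simp add: card_cartesian_product card_exponent_box card_PiE)
  qed
  have bT: "b i * z \<in> T (Suc j)" if "i \<in> S" and zT: "z \<in> T j" for i j z
  proof -
    obtain \<beta> \<gamma> where z: "\<beta> \<in> exponent_box C \<tau>" "\<gamma> \<in> S \<rightarrow>\<^sub>E {..<j}"
      "z = Poly_Mapping.single \<beta> 1 * (\<Prod>i\<in>S. b i ^ \<gamma> i)"
      using zT by (auto simp: T_def)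
    define \<gamma>' where "\<gamma>' = \<gamma>(i := Suc (\<gamma> i))"
    have "\<gamma>' \<in> S \<rightarrow>\<^sub>E {..<Suc j}"
      using z(2) that(1) by (auto simp: \<gamma>'_def PiE_iff extensional_def less_SucI)
    moreover have "b i * z = Poly_Mapping.single \<beta> 1 * (\<Prod>i\<in>S. b i ^ \<gamma>' i)"
    proof -
      have "(\<Prod>l\<in>S - {i}. b l ^ \<gamma>' l) = (\<Prod>l\<in>S - {i}. b l ^ \<gamma> l)"
        by (intro prod.cong) (auto simp: \<gamma>'_def)
      then show ?thesis
        using assms(2) that(1) z(3) by (simp add: prod.remove[of S i] \<gamma>'_def mult_ac)
    qed
    ultimately show ?thesis using z(1) unfolding T_def by (intro image_eqI[of _ _ "(\<beta>, \<gamma>')"]) auto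
  qed
  have span: "span_mod_order C j (T j) p" if "mpoly_vars p \<subseteq> C" for j p
    using that
  proof (induction j arbitrary: p)
    case 0
    show ?case by (intro span_mod_order_of_order) simp
  next
    case (Suc j)
    have "span_mod_order C (Suc j) (T (Suc j)) (Poly_Mapping.single t c)"
      if t: "t \<in> Poly_Mapping.keys p" for t c
    proof -
      have tC: "Poly_Mapping.keys t \<subseteq> C" using Suc.prems t by (auto simp: mpoly_vars_def)
      show ?thesis
      proof (cases "t \<in> exponent_box C \<tau>")
        case True
        have "Poly_Mapping.single t 1 * (\<Prod>i\<in>S. b i ^ (restrict (\<lambda>_. 0) S) i) \<in> T (Suc j)"
          unfolding T_def using True
          by (intro image_eqI[of _ _ "(t, restrict (\<lambda>_. 0) S)"]) auto
        then have "Poly_Mapping.single t 1 \<in> T (Suc j)" by simp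
        from span_mod_order_base[OF finT this, of C "Suc j" c] show ?thesis
          by (simp add: mult_single)
      next
        case False
        then obtain v where v: "v \<in> C" "\<tau> \<le> Poly_Mapping.lookup t v"
          using tC by (auto simp: exponent_box_def not_less)
        define u where "u = t - Poly_Mapping.single v (k v)"
        have u: "u + Poly_Mapping.single v (k v) = t"
          using v \<tau>[OF v(1)]
          by (intro poly_mapping_eqI) (auto simp: u_def lookup_add lookup_minus lookup_single when_def)
        have var_pow: "mpoly_var v ^ l = Poly_Mapping.single (Poly_Mapping.single v l) (1 :: 'k)" for l
          by (induction l) (simp_all add: mpoly_var_def mult_single single_add[symmetric])
        have "Poly_Mapping.single t c = Poly_Mapping.single u c * mpoly_var v ^ k v"
          by (simp add: var_pow mult_single u)
        also have "\<dots> = (\<Sum>i\<in>S. b i * (Poly_Mapping.single u c * g v i))"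
          by (simp add: k[OF v(1)] sum_distrib_left mult_ac)
        finally have eq: "Poly_Mapping.single t c = (\<Sum>i\<in>S. b i * (Poly_Mapping.single u c * g v i))" .
        have "Poly_Mapping.keys u \<subseteq> C" using tC u keys_add_nat[of u] by auto
        then have uC: "mpoly_vars (Poly_Mapping.single u c) \<subseteq> C"
          by (rule order_trans[OF mpoly_vars_single])
        show ?thesis
          unfolding eq
          by (intro span_mod_order_sum span_mod_order_mult[of C j "T j"] Suc.IH b finT bT
            mpoly_vars_multI uC g[OF v(1)])
      qed
    qed
    then show ?case by (subst mpoly_eq_sum_monomials[of p]) (rule span_mod_order_sum)
  qed
  have "e ^ card C \<le> \<tau> ^ card C * card C ^ card S * e ^ card S" if e: "e \<ge> 1" for e
  proof (rule ccontr)
    assume less: "\<not> ?thesis"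
    define j where "j = card C * e"
    define A where "A = exponent_box C e"
    have "finite A" unfolding A_def by (rule finite_exponent_box[OF assms(1)])
    have "\<forall>t. \<exists>k. t \<in> A \<longrightarrow> vanishing_order_ge C j
      (Poly_Mapping.single t 1 - (\<Sum>z\<in>T j. mpoly_const (k z) * z))"
    proof (intro allI)
      fix t
      have "span_mod_order C j (T j) (Poly_Mapping.single t 1)" if "t \<in> A"
      proof (rule span)
        have "Poly_Mapping.keys t \<subseteq> C" using that by (simp add: A_def exponent_box_def)
        then show "mpoly_vars (Poly_Mapping.single t (1 :: 'k)) \<subseteq> C"
          by (rule order_trans[OF mpoly_vars_single])
      qed
      then show "\<exists>k. t \<in> A \<longrightarrow> vanishing_order_ge C j
          (Poly_Mapping.single t 1 - (\<Sum>z\<in>T j. mpoly_const (k z) * z))"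
        unfolding span_mod_order_def by blast
    qed
    from choice[OF this] obtain M where M: "\<And>t. t \<in> A \<Longrightarrow> vanishing_order_ge C j
      (Poly_Mapping.single t 1 - (\<Sum>z\<in>T j. mpoly_const (M t z) * z))"
      by blast
    have "card (T j) \<le> \<tau> ^ card C * j ^ card S" by (rule cardT)
    also have "\<dots> < card A"
      using less assms(1) by (simp add: j_def A_def card_exponent_box power_mult_distrib mult.assoc)
    finally obtain x where x: "\<exists>t\<in>A. x t \<noteq> 0" "\<And>z. z \<in> T j \<Longrightarrow> (\<Sum>t\<in>A. x t * M t z) = 0"
      using underdetermined_system_solvable[OF finT \<open>finite A\<close>, of j M] by blast
    \<comment> \<open>The chosen combination of the monomials in \<open>A\<close> cancels all elements of the spanning set.\<close>
    have "vanishing_order_ge C j (\<Sum>t\<in>A. mpoly_const (x t) *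
        (Poly_Mapping.single t 1 - (\<Sum>z\<in>T j. mpoly_const (M t z) * z)))"
      by (intro vanishing_order_ge_sum vanishing_order_ge_const_mult M)
    also have "(\<Sum>t\<in>A. mpoly_const (x t) *
        (Poly_Mapping.single t 1 - (\<Sum>z\<in>T j. mpoly_const (M t z) * z))) =
        (\<Sum>t\<in>A. Poly_Mapping.single t (x t)) -
        (\<Sum>t\<in>A. \<Sum>z\<in>T j. mpoly_const (x t * M t z) * z)"
      by (simp add: right_diff_distrib sum_subtractf sum_distrib_left mult_single mult.assoc[symmetric])
    also have "(\<Sum>t\<in>A. \<Sum>z\<in>T j. mpoly_const (x t * M t z) * z) =
        (\<Sum>z\<in>T j. (\<Sum>t\<in>A. mpoly_const (x t * M t z)) * z)"
      by (subst sum.swap) (simp add: sum_distrib_right)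
    also have "\<dots> = 0"
    proof (rule sum.neutral, rule ballI)
      fix z assume "z \<in> T j"
      have "(\<Sum>t\<in>A. mpoly_const (x t * M t z)) =
          (mpoly_const (\<Sum>t\<in>A. x t * M t z) :: ('v, 'k) mpolynomial)"
        by (rule poly_mapping_eqI) (simp add: lookup_sum lookup_single when_def)
      then show "(\<Sum>t\<in>A. mpoly_const (x t * M t z)) * z = 0" using x(2)[OF \<open>z \<in> T j\<close>] by simp
    qed
    finally have order: "vanishing_order_ge C j (\<Sum>t\<in>A. Poly_Mapping.single t (x t))" by simp
    obtain t where t: "t \<in> A" "x t \<noteq> 0" using x(1) by blast
    have "Poly_Mapping.lookup (\<Sum>t\<in>A. Poly_Mapping.single t (x t)) t = x t"
      using t(1) \<open>finite A\<close> by (simp add: lookup_sum lookup_single when_def)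
    then have "j \<le> (\<Sum>v\<in>C. Poly_Mapping.lookup t v)"
      using order t(2) by (auto simp: vanishing_order_ge_def in_keys_iff)
    also have "\<dots> < (\<Sum>v\<in>C. e)"
      using t(1) False assms(1) by (intro sum_strict_mono) (auto simp: A_def exponent_box_def)
    finally show False by (simp add: j_def)
  qed
  then show ?thesis by (rule power_bound_imp_le)
qed simp


section \<open>Setting variables to one\<close>

text \<open>
  Setting the variables outside a minimal cover \<open>C\<close> to one takes the place of localising at the
  coordinate prime of \<open>C\<close>: squarefree monomials lose their factors outside \<open>C\<close>, and all computations
  stay inside the polynomial ring.
\<close>

definition restrict_exponent :: "'v set \<Rightarrow> ('v \<Rightarrow>\<^sub>0 nat) \<Rightarrow> ('v \<Rightarrow>\<^sub>0 nat)" where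
  "restrict_exponent C = Poly_Mapping.mapp (\<lambda>v e. if v \<in> C then e else 0)"

definition set_other_vars_one :: "'v set \<Rightarrow> ('v, 'k::field) mpolynomial \<Rightarrow> ('v, 'k) mpolynomial" where
  "set_other_vars_one C p =
     (\<Sum>t\<in>Poly_Mapping.keys p. Poly_Mapping.single (restrict_exponent C t) (Poly_Mapping.lookup p t))"

lemma lookup_restrict_exponent:
  "Poly_Mapping.lookup (restrict_exponent C t) v = (if v \<in> C then Poly_Mapping.lookup t v else 0)"
  by (auto simp: restrict_exponent_def lookup_mapp when_def in_keys_iff)

lemma keys_restrict_exponent: "Poly_Mapping.keys (restrict_exponent C t) = Poly_Mapping.keys t \<inter> C"
  by (auto simp: in_keys_iff lookup_restrict_exponent split: if_splits)

lemma restrict_exponent_add: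
  "restrict_exponent C (s + t) = restrict_exponent C s + restrict_exponent C t"
  by (rule poly_mapping_eqI) (simp add: lookup_add lookup_restrict_exponent)

lemma set_other_vars_one_single:
  "set_other_vars_one C (Poly_Mapping.single t c) = Poly_Mapping.single (restrict_exponent C t) c"
  by (simp add: set_other_vars_one_def)

lemma set_other_vars_one_add:
  "set_other_vars_one C (p + q) = set_other_vars_one C p + set_other_vars_one C q"
  unfolding set_other_vars_one_def by (rule setsum_keys_plus_distrib) (simp_all add: single_add)

lemma set_other_vars_one_sum:
  "set_other_vars_one C (\<Sum>i\<in>A. f i) = (\<Sum>i\<in>A. set_other_vars_one C (f i))"
  by (induction A rule: infinite_finite_induct)
    (simp_all add: set_other_vars_one_add, simp_all add: set_other_vars_one_def)

lemma set_other_vars_one_mult: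
  "set_other_vars_one C (p * q) = set_other_vars_one C p * set_other_vars_one C q"
proof -
  have "p * q = (\<Sum>a\<in>Poly_Mapping.keys p. \<Sum>b\<in>Poly_Mapping.keys q.
      Poly_Mapping.single (a + b) (Poly_Mapping.lookup p a * Poly_Mapping.lookup q b))"
    by (subst (1) mpoly_eq_sum_monomials[of p], subst (1) mpoly_eq_sum_monomials[of q])
      (simp add: sum_product mult_single)
  then have "set_other_vars_one C (p * q) = (\<Sum>a\<in>Poly_Mapping.keys p. \<Sum>b\<in>Poly_Mapping.keys q.
      Poly_Mapping.single (restrict_exponent C a) (Poly_Mapping.lookup p a) *
      Poly_Mapping.single (restrict_exponent C b) (Poly_Mapping.lookup q b))"
    by (simp add: set_other_vars_one_sum set_other_vars_one_single restrict_exponent_add mult_single)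
  then show ?thesis by (simp add: set_other_vars_one_def sum_product)
qed

lemma set_other_vars_one_power:
  "set_other_vars_one C (p ^ k) = set_other_vars_one C p ^ k"
proof (induction k)
  case 0
  have "restrict_exponent C 0 = 0" by (rule poly_mapping_eqI) (simp add: lookup_restrict_exponent)
  then show ?case using set_other_vars_one_single[of C 0 1] by simp
qed (simp add: set_other_vars_one_mult)

lemma keys_set_other_vars_one:
  "Poly_Mapping.keys (set_other_vars_one C p) \<subseteq> restrict_exponent C ` Poly_Mapping.keys p"
  unfolding set_other_vars_one_def by (rule order_trans[OF keys_sum_subset]) auto

lemma mpoly_vars_set_other_vars_one: "mpoly_vars (set_other_vars_one C p) \<subseteq> C"
  using keys_set_other_vars_one[of C p] by (auto simp: mpoly_vars_def keys_restrict_exponent)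

lemma vanishing_order_set_other_vars_one:
  assumes "finite C" "p \<in> coordinate_prime V C"
  shows "vanishing_order_ge C 1 (set_other_vars_one C p)"
  unfolding vanishing_order_ge_def
proof
  fix s assume "s \<in> Poly_Mapping.keys (set_other_vars_one C p)"
  then obtain t where t: "t \<in> Poly_Mapping.keys p" "s = restrict_exponent C t"
    using keys_set_other_vars_one by blast
  then obtain v where v: "v \<in> C" "v \<in> Poly_Mapping.keys t"
    using assms(2) by (auto simp: coordinate_prime_def)
  then have "1 \<le> Poly_Mapping.lookup s v" by (simp add: t lookup_restrict_exponent in_keys_iff)
  also have "\<dots> \<le> (\<Sum>v\<in>C. Poly_Mapping.lookup s v)"
    using v assms(1) by (intro member_le_sum) auto
  finally show "1 \<le> (\<Sum>v\<in>C. Poly_Mapping.lookup s v)" .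
qed

lemma set_other_vars_one_sqfree_monomial:
  assumes "finite G"
  shows "set_other_vars_one C (sqfree_monomial G) = sqfree_monomial (G \<inter> C)"
proof -
  have "restrict_exponent C (sqfree_exponent G) = sqfree_exponent (G \<inter> C)"
    using assms by (intro poly_mapping_eqI) (simp add: lookup_restrict_exponent lookup_sqfree_exponent)
  then show ?thesis
    using assms by (simp add: sqfree_monomial_eq_single set_other_vars_one_single)
qed


section \<open>Big height and arithmetical rank of squarefree monomial ideals\<close>

text \<open>
  Set the variables outside \<open>C\<close> to one. The equations lie in the coordinate prime of \<open>C\<close>, so their
  images have no constant term. An edge that meets \<open>C\<close> in \<open>v\<close> only becomes the variable \<open>v\<close>, so a
  power of \<open>v\<close> lies in the ideal of the images.
\<close>

lemma card_minimal_vertex_cover_le_equations: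
  fixes H :: "'v set set" and a :: "nat \<Rightarrow> ('v, 'k::field) mpolynomial"
  assumes "finite V" and H: "\<And>G. G \<in> H \<Longrightarrow> G \<subseteq> V"
    and C: "minimal_vertex_cover V H C"
    and a: "\<And>i. i \<in> {1..s} \<Longrightarrow> mpoly_vars (a i) \<subseteq> V"
    and rad: "radical (mpoly_ring V) (Idl\<^bsub>mpoly_ring V\<^esub> (a ` {1..s})) =
      radical (mpoly_ring V) (Idl\<^bsub>mpoly_ring V\<^esub> (sqfree_monomial ` H))"
  shows "card C \<le> s"
proof -
  let ?R = "mpoly_ring V :: ('v, 'k) mpolynomial ring"
  let ?m = "sqfree_monomial :: 'v set \<Rightarrow> ('v, 'k) mpolynomial"
  let ?\<phi> = "set_other_vars_one C :: ('v, 'k) mpolynomial \<Rightarrow> _"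
  define I where "I = Idl\<^bsub>?R\<^esub> (?m ` H)"
  define J where "J = Idl\<^bsub>?R\<^esub> (a ` {1..s})"
  interpret R: ring ?R by (rule ring_mpoly_ring)
  have finC: "finite C" using C assms(1) finite_subset unfolding minimal_vertex_cover_def by blast
  have aR: "a ` {1..s} \<subseteq> carrier ?R" using a by (intro image_subsetI) simp
  then have J: "ideal J ?R" and aJ: "a ` {1..s} \<subseteq> J"
    unfolding J_def by (rule R.genideal_ideal, rule R.genideal_self)
  have mR: "?m ` H \<subseteq> carrier ?R"
  proof (rule image_subsetI)
    fix G assume "G \<in> H"
    then show "?m G \<in> carrier ?R"
      using order_trans[OF mpoly_vars_sqfree_monomial[OF finite_subset[OF H assms(1)]] H] by simp
  qed
  then have I: "ideal I ?R" and mI: "?m ` H \<subseteq> I"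
    unfolding I_def by (rule R.genideal_ideal, rule R.genideal_self)
  have "I \<subseteq> coordinate_prime V C"
    using C unfolding I_def minimal_vertex_cover_def
    by (subst sqfree_ideal_subset_coordinate_prime_iff[OF assms(1) H]) auto
  have "card C \<le> card {1..s}"
  proof (rule card_variables_le_card_equations[OF finC, where b = "\<lambda>i. ?\<phi> (a i)"])
    fix i assume i: "i \<in> {1..s}"
    have "a i \<in> radical ?R I"
      using subset_radical[OF J] aJ i rad unfolding I_def J_def by blast
    then obtain k where "a i ^ k \<in> I" by (auto simp: radical_def)
    then have "a i ^ k \<in> coordinate_prime V C" using \<open>I \<subseteq> _\<close> by blast
    then have "a i \<in> coordinate_prime V C"
      by (rule primeideal_mpoly_power[OF primeideal_coordinate_prime a[OF i]])
    then show "vanishing_order_ge C 1 (?\<phi> (a i))"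
      by (rule vanishing_order_set_other_vars_one[OF finC])
  next
    fix v assume "v \<in> C"
    then obtain G where G: "G \<in> H" "G \<inter> C = {v}" using C by (auto simp: minimal_vertex_cover_def)
    have "?m G \<in> radical ?R J"
      using subset_radical[OF I] mI G(1) rad unfolding I_def J_def by blast
    then obtain k where "?m G ^ k \<in> J" by (auto simp: radical_def)
    then obtain g where g: "?m G ^ k = (\<Sum>i\<in>{1..s}. a i * g i)"
      unfolding J_def by (rule genideal_mpoly_combination[OF a, rotated 2]) auto
    have "mpoly_var v ^ k = ?\<phi> (?m G ^ k)"
      using G finite_subset[OF H[OF G(1)] assms(1)]
      by (simp add: set_other_vars_one_power set_other_vars_one_sqfree_monomial
        mpoly_var_eq_sqfree_monomial)
    also have "\<dots> = (\<Sum>i\<in>{1..s}. ?\<phi> (a i) * ?\<phi> (g i))"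
      by (simp add: g set_other_vars_one_sum set_other_vars_one_mult)
    finally show "\<exists>k g. (\<forall>i\<in>{1..s}. mpoly_vars (g i) \<subseteq> C) \<and>
        mpoly_var v ^ k = (\<Sum>i\<in>{1..s}. ?\<phi> (a i) * g i)"
      by (intro exI[of _ k] exI[of _ "\<lambda>i. ?\<phi> (g i)"] conjI ballI mpoly_vars_set_other_vars_one)
  qed simp
  then show ?thesis by simp
qed

lemma bight_sqfree_ideal_le_ara:
  fixes H :: "'v set set"
  assumes "finite V" and H: "\<And>G. G \<in> H \<Longrightarrow> G \<subseteq> V"
  defines "I \<equiv> Idl\<^bsub>mpoly_ring V\<^esub> (sqfree_monomial ` H :: ('v, 'k::field) mpolynomial set)"
  shows "bight (mpoly_ring V) I \<le> ara (mpoly_ring V) I"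
  unfolding bight_def
proof (rule SUP_least)
  fix P assume "P \<in> minimal_primes (mpoly_ring V) I"
  then obtain C where P: "P = coordinate_prime V C" and C: "minimal_vertex_cover V H C"
    using minimal_primes_sqfree_ideal[of V H, OF assms(1,2)] unfolding I_def by blast
  have "C \<subseteq> V" using C by (simp add: minimal_vertex_cover_def)
  have "enat (card C) \<le> ara (mpoly_ring V) I"
    unfolding ara_def
  proof (rule Inf_greatest, clarify)
    fix s and a :: "nat \<Rightarrow> ('v, 'k) mpolynomial"
    assume "\<forall>i\<in>{1..s}. a i \<in> carrier (mpoly_ring V)"
      "radical (mpoly_ring V) (Idl\<^bsub>mpoly_ring V\<^esub> (a ` {1..s})) = radical (mpoly_ring V) I"
    then show "enat (card C) \<le> enat s"
      using card_minimal_vertex_cover_le_equations[OF assms(1) H C, of s a] by (simp add: I_def)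
  qed
  then show "prime_height (mpoly_ring V) P \<le> ara (mpoly_ring V) I"
    by (simp add: P prime_height_coordinate_prime[OF assms(1) \<open>C \<subseteq> V\<close>])
qed

lemma card_minimal_vertex_cover_le_bight:
  fixes H :: "'v set set"
  assumes "finite V" and H: "\<And>G. G \<in> H \<Longrightarrow> G \<subseteq> V" and C: "minimal_vertex_cover V H C"
  shows "enat (card C) \<le> bight (mpoly_ring V)
    (Idl\<^bsub>mpoly_ring V\<^esub> (sqfree_monomial ` H :: ('v, 'k::field) mpolynomial set))"
proof -
  have "C \<subseteq> V" using C by (simp add: minimal_vertex_cover_def)
  have "enat (card C) =
      prime_height (mpoly_ring V) (coordinate_prime V C :: ('v, 'k) mpolynomial set)"
    by (simp add: prime_height_coordinate_prime[OF assms(1) \<open>C \<subseteq> V\<close>])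
  also have "\<dots> \<le> bight (mpoly_ring V)
      (Idl\<^bsub>mpoly_ring V\<^esub> (sqfree_monomial ` H :: ('v, 'k) mpolynomial set))"
    unfolding bight_def
    by (intro SUP_upper, subst minimal_primes_sqfree_ideal[OF assms(1) H]) (use C in auto)
  finally show ?thesis .
qed


section \<open>Complexes with facets attached at every vertex\<close>

locale whiskered_complex =
  fixes \<Delta> \<Delta>' :: "'v set set"
    and n :: nat and x :: "nat \<Rightarrow> 'v"
    and m :: "nat \<Rightarrow> nat" and F :: "nat \<Rightarrow> nat \<Rightarrow> 'v set"
  assumes complex: "simplicial_complex \<Delta>"
    and n: "n \<ge> 1" and inj: "inj_on x {1..n}" and vertices: "vertices \<Delta> = x ` {1..n}"
    and m: "\<And>i. i \<in> {1..n} \<Longrightarrow> m i \<ge> 1"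
    and finite_F: "\<And>i j. i \<in> {1..n} \<Longrightarrow> j \<in> {1..m i} \<Longrightarrow> finite (F i j)"
    and dim_F: "\<And>i j. i \<in> {1..n} \<Longrightarrow> j \<in> {1..m i} \<Longrightarrow> face_dim (F i j) \<ge> 1"
    and F_vertices: "\<And>i j. i \<in> {1..n} \<Longrightarrow> j \<in> {1..m i} \<Longrightarrow> F i j \<inter> vertices \<Delta> = {x i}"
    and F_same: "\<And>i j k. i \<in> {1..n} \<Longrightarrow> j \<in> {1..m i} \<Longrightarrow> k \<in> {1..m i} \<Longrightarrow> j \<noteq> k \<Longrightarrow>
      F i j \<inter> F i k = {x i}"
    and F_disjoint: "\<And>i h j k. i \<in> {1..n} \<Longrightarrow> h \<in> {1..n} \<Longrightarrow> i \<noteq> h \<Longrightarrow> j \<in> {1..m i} \<Longrightarrow>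
      k \<in> {1..m h} \<Longrightarrow> F i j \<inter> F h k = {}"
    and \<Delta>': "\<Delta>' = \<Delta> \<union> (\<Union>i\<in>{1..n}. \<Union>j\<in>{1..m i}. simplex_on (F i j))"
begin

abbreviation "whiskers \<equiv> Sigma {1..n} (\<lambda>i. {1..m i})"

lemma face_subset_vertices: "G \<in> \<Delta> \<Longrightarrow> G \<subseteq> x ` {1..n}"
  using complex unfolding vertices[symmetric] simplicial_complex_def vertices_def by blast

lemma x_in_F: "i \<in> {1..n} \<Longrightarrow> j \<in> {1..m i} \<Longrightarrow> x i \<in> F i j"
  using F_vertices by blast

lemma F_subset_vertices: "i \<in> {1..n} \<Longrightarrow> j \<in> {1..m i} \<Longrightarrow> F i j \<subseteq> vertices \<Delta>'"
  by (auto simp: vertices_def \<Delta>' simplex_on_def)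

lemma x_in_vertices: "i \<in> {1..n} \<Longrightarrow> x i \<in> vertices \<Delta>'"
  using vertices by (auto simp: vertices_def \<Delta>')

lemma finite_vertices: "finite (vertices \<Delta>')"
proof (rule finite_subset)
  show "vertices \<Delta>' \<subseteq> \<Union>\<Delta>'" by (auto simp: vertices_def)
  show "finite (\<Union>\<Delta>')"
  proof (rule finite_Union)
    show "finite \<Delta>'"
      using complex finite_F by (auto simp: \<Delta>' simplicial_complex_def simplex_on_def)
    show "finite G" if "G \<in> \<Delta>'" for G
      using that complex finite_F
      by (auto simp: \<Delta>' simplicial_complex_def simplex_on_def intro: finite_subset)
  qed
qed

lemma private_vertex_exists:
  assumes "i \<in> {1..n}" "j \<in> {1..m i}"
  shows "\<exists>y. y \<in> F i j \<and> y \<notin> x ` {1..n}"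
proof -
  have "card {x i} < card (F i j)" using dim_F[OF assms] by (simp add: face_dim_def)
  then have "\<not> F i j \<subseteq> {x i}" using card_mono[of "{x i}" "F i j"] by fastforce
  then show ?thesis using F_vertices[OF assms] unfolding vertices by blast
qed

lemma F_subset_F_imp_eq:
  assumes "(i, j) \<in> whiskers" "(k, l) \<in> whiskers" and sub: "F i j \<subseteq> F k l"
  shows "i = k \<and> j = l"
proof -
  have ij: "i \<in> {1..n}" "j \<in> {1..m i}" and kl: "k \<in> {1..n}" "l \<in> {1..m k}" using assms by auto
  obtain y where y: "y \<in> F i j" "y \<notin> x ` {1..n}" using private_vertex_exists[OF ij] by blast
  have "i = k" using F_disjoint[OF ij(1) kl(1) _ ij(2) kl(2)] y(1) sub by blast
  moreover have "j = l"
  proof (rule ccontr)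
    assume "j \<noteq> l"
    then have "F i j \<inter> F i l = {x i}" using F_same[OF ij] kl \<open>i = k\<close> by blast
    then show False using y sub ij \<open>i = k\<close> by blast
  qed
  ultimately show ?thesis by blast
qed

text \<open>
  A facet of \<open>\<Delta>\<close> may fail to be a facet of \<open>\<Delta>'\<close>: an isolated vertex \<open>x i\<close> of \<open>\<Delta>\<close> is absorbed by \<open>F i j\<close>.
  The sets \<open>F i j\<close> do remain maximal, because each of them has a vertex that lies in no face of \<open>\<Delta>\<close>
  and in no other \<open>F k l\<close>.
\<close>

lemma F_facet:
  assumes "i \<in> {1..n}" "j \<in> {1..m i}"
  shows "F i j \<in> facets \<Delta>'"
proof -
  have "G = F i j" if G: "G \<in> \<Delta>'" "F i j \<subseteq> G" for G
  proof -
    have "\<not> G \<in> \<Delta>" using face_subset_vertices private_vertex_exists[OF assms] G by blast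
    then obtain k l where kl: "k \<in> {1..n}" "l \<in> {1..m k}" "G \<subseteq> F k l"
      using G by (auto simp: \<Delta>' simplex_on_def)
    then have "F i j = F k l" using F_subset_F_imp_eq[of i j k l] assms G by auto
    then show ?thesis using kl G by blast
  qed
  moreover have "F i j \<in> \<Delta>'" unfolding \<Delta>' simplex_on_def using assms by blast
  ultimately show ?thesis by (auto simp: facets_def)
qed

lemma facet_cases:
  assumes "G \<in> facets \<Delta>'"
  obtains "G \<subseteq> x ` {1..n}" | i j where "i \<in> {1..n}" "j \<in> {1..m i}" "G = F i j"
proof (cases "G \<in> \<Delta>")
  case True
  then show ?thesis using that(1) face_subset_vertices by blast
next
  case False
  then obtain i j where ij: "i \<in> {1..n}" "j \<in> {1..m i}" "G \<subseteq> F i j"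
    using assms by (auto simp: facets_def \<Delta>' simplex_on_def)
  then have "F i j = G"
    using assms F_facet[OF ij(1,2)] by (auto simp: facets_def)
  then show ?thesis using that(2) ij by blast
qed

lemma facet_subset_vertices: "G \<in> facets \<Delta>' \<Longrightarrow> G \<subseteq> vertices \<Delta>'"
  using x_in_vertices F_subset_vertices by (elim facet_cases) blast+

lemma facet_nonempty: "G \<in> facets \<Delta>' \<Longrightarrow> G \<noteq> {}"
proof
  assume "G \<in> facets \<Delta>'" "G = {}"
  then have "F 1 1 = {}"
    using F_facet[of 1 1] n m[of 1] by (auto simp: facets_def)
  then show False using x_in_F[of 1 1] n m[of 1] by simp
qed

text \<open>Dependence refers to the facets of \<open>\<Delta>'\<close>; it means that the product of the variables \<open>x i\<close>
  with \<open>i \<in> D\<close> lies in the facet ideal.\<close>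

definition dependent :: "nat set \<Rightarrow> bool" where
  "dependent D \<longleftrightarrow> (\<exists>G\<in>facets \<Delta>'. G \<subseteq> x ` D)"

text \<open>The size of the minimal cover whose set of vertices in \<open>\<Delta>\<close> is the complement of \<open>S\<close>.\<close>

definition cover_size :: "nat set \<Rightarrow> nat" where
  "cover_size S = (\<Sum>i\<in>S. m i) + (n - card S)"

definition max_cover_size :: nat where
  "max_cover_size = Max (cover_size ` {S. S \<subseteq> {1..n} \<and> \<not> dependent S})"

lemma dependent_mono: "dependent D \<Longrightarrow> D \<subseteq> E \<Longrightarrow> dependent E"
  unfolding dependent_def by (meson image_mono order_trans)

lemma independent_empty: "\<not> dependent {}"
  using facet_nonempty by (auto simp: dependent_def)

lemma cover_size_le_max: "S \<subseteq> {1..n} \<Longrightarrow> \<not> dependent S \<Longrightarrow> cover_size S \<le> max_cover_size"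
  unfolding max_cover_size_def by (intro Max_ge) auto

lemma max_cover_size_attained:
  obtains S where "S \<subseteq> {1..n}" "\<not> dependent S" "cover_size S = max_cover_size"
proof -
  have "max_cover_size \<in> cover_size ` {S. S \<subseteq> {1..n} \<and> \<not> dependent S}"
    unfolding max_cover_size_def using independent_empty by (intro Max_in) auto
  then show ?thesis using that by auto
qed

lemma n_le_max_cover_size: "n \<le> max_cover_size"
  using cover_size_le_max[of "{}"] independent_empty by (simp add: cover_size_def)

text \<open>This bound makes the two kinds of levels compatible: the level of \<open>A\<close> is at least
  \<open>n - card (fst ` A)\<close>, hence larger than that of any dependent set strictly above \<open>fst ` A\<close>.\<close>

lemma card_whiskers_le:
  assumes "A \<subseteq> whiskers" "\<not> dependent (fst ` A)"
  shows "card A + (n - card (fst ` A)) \<le> max_cover_size"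
proof -
  have S: "fst ` A \<subseteq> {1..n}" using assms(1) by auto
  then have "finite (fst ` A)" by (rule finite_subset) simp
  have "A \<subseteq> Sigma (fst ` A) (\<lambda>i. {1..m i})" using assms(1) by force
  then have "card A \<le> card (Sigma (fst ` A) (\<lambda>i. {1..m i}))"
    using \<open>finite (fst ` A)\<close> by (intro card_mono) auto
  also have "\<dots> = (\<Sum>i\<in>fst ` A. m i)" using \<open>finite (fst ` A)\<close> by (subst card_SigmaI) auto
  finally show ?thesis
    using cover_size_le_max[OF S assms(2)] by (simp add: cover_size_def)
qed

text \<open>
  The chosen cover meets every \<open>F i j\<close> in exactly one vertex, and each of its vertices is the one in
  some \<open>F i j\<close>; these are the private edges. It meets the other facets since they are not contained in
  the independent set \<open>x ` S\<close>.
\<close>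

lemma minimal_vertex_cover_of_max_size:
  obtains C where "minimal_vertex_cover (vertices \<Delta>') (facets \<Delta>') C" "card C = max_cover_size"
proof -
  obtain S where S: "S \<subseteq> {1..n}" "\<not> dependent S" "cover_size S = max_cover_size"
    by (rule max_cover_size_attained)
  have "finite S" using S(1) by (rule finite_subset) simp
  have "\<forall>p\<in>whiskers. \<exists>y. y \<in> F (fst p) (snd p) \<and> y \<notin> x ` {1..n}"
    using private_vertex_exists by auto
  from bchoice[OF this] obtain y
    where y: "\<forall>p\<in>whiskers. y p \<in> F (fst p) (snd p) \<and> y p \<notin> x ` {1..n}" by blast
  define B where "B = Sigma S (\<lambda>i. {1..m i})"
  define C where "C = x ` ({1..n} - S) \<union> y ` B"
  have B: "B \<subseteq> whiskers" using S(1) by (auto simp: B_def)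
  have y_unique: "(k, l) = (i, j)" if "(k, l) \<in> whiskers" "(i, j) \<in> whiskers" "y (k, l) \<in> F i j" for i j k l
  proof -
    have ij: "i \<in> {1..n}" "j \<in> {1..m i}" and kl: "k \<in> {1..n}" "l \<in> {1..m k}" using that by auto
    have ykl: "y (k, l) \<in> F k l" "y (k, l) \<notin> x ` {1..n}" using y that(1) by force+
    have "k = i" using F_disjoint[OF kl(1) ij(1) _ kl(2) ij(2)] ykl(1) that(3) by blast
    moreover have "l = j"
    proof (rule ccontr)
      assume "l \<noteq> j"
      then have "F k l \<inter> F k j = {x k}" using F_same[OF kl] ij \<open>k = i\<close> by blast
      then show False using ykl that(3) kl \<open>k = i\<close> by blast
    qed
    ultimately show ?thesis by blast
  qed
  have x_unique: "k = i" if "i \<in> {1..n}" "j \<in> {1..m i}" "k \<in> {1..n}" "x k \<in> F i j" for i j k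
    using F_vertices[OF that(1,2)] that inj_onD[OF inj, of k i] unfolding vertices by blast
  have F_C: "F i j \<inter> C = (if i \<in> S then {y (i, j)} else {x i})"
    if "i \<in> {1..n}" "j \<in> {1..m i}" for i j
  proof -
    have x_part: "F i j \<inter> x ` ({1..n} - S) = (if i \<in> S then {} else {x i})"
    proof (intro equalityI subsetI)
      fix z assume "z \<in> F i j \<inter> x ` ({1..n} - S)"
      then obtain k where "k \<in> {1..n}" "k \<notin> S" "z = x k" "x k \<in> F i j" by blast
      moreover from this have "k = i" using x_unique[OF that] by blast
      ultimately show "z \<in> (if i \<in> S then {} else {x i})" by simp
    next
      fix z assume "z \<in> (if i \<in> S then {} else {x i})"
      then have "i \<notin> S" "z = x i" by (simp_all split: if_splits)
      then show "z \<in> F i j \<inter> x ` ({1..n} - S)" using x_in_F[OF that] that(1) by blast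
    qed
    have "y (i, j) \<in> F i j" using y that by force
    moreover have "p = (i, j)" if "p \<in> B" "y p \<in> F i j" for p
      using y_unique[of "fst p" "snd p" i j] that B \<open>i \<in> {1..n}\<close> \<open>j \<in> {1..m i}\<close> by auto
    ultimately have "F i j \<inter> y ` B = (if i \<in> S then {y (i, j)} else {})"
      using that(2) by (auto simp: B_def)
    then show ?thesis using x_part unfolding C_def Int_Un_distrib by simp
  qed
  have "minimal_vertex_cover (vertices \<Delta>') (facets \<Delta>') C"
    unfolding minimal_vertex_cover_def
  proof (intro conjI ballI)
    have "y p \<in> vertices \<Delta>'" if "p \<in> B" for p
    proof -
      have "p \<in> whiskers" using that B by blast
      then have "y p \<in> F (fst p) (snd p)" using y by blast
      moreover have "F (fst p) (snd p) \<subseteq> vertices \<Delta>'"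
        using \<open>p \<in> whiskers\<close> by (intro F_subset_vertices) auto
      ultimately show ?thesis by blast
    qed
    then show "C \<subseteq> vertices \<Delta>'" using x_in_vertices by (auto simp: C_def)
  next
    fix G assume G: "G \<in> facets \<Delta>'"
    then show "G \<inter> C \<noteq> {}"
    proof (cases rule: facet_cases)
      case 1
      have "\<not> G \<subseteq> x ` S" using S(2) G by (auto simp: dependent_def)
      then show ?thesis using 1 by (auto simp: C_def)
    next
      case (2 i j)
      then show ?thesis using F_C[of i j] by (simp split: if_splits)
    qed
  next
    fix v assume "v \<in> C"
    then consider i where "i \<in> {1..n} - S" "v = x i" | i j where "(i, j) \<in> B" "v = y (i, j)"
      by (auto simp: C_def)
    then show "\<exists>G\<in>facets \<Delta>'. G \<inter> C = {v}"
    proof cases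
      case 1
      then show ?thesis using F_facet[of i 1] F_C[of i 1] m[of i] by auto
    next
      case (2 i j)
      then have ij: "i \<in> S" "i \<in> {1..n}" "j \<in> {1..m i}" using S(1) by (auto simp: B_def)
      then have "F i j \<inter> C = {v}" using F_C[OF ij(2,3)] 2(2) by simp
      then show ?thesis using F_facet[OF ij(2,3)] by blast
    qed
  qed
  moreover have "card C = max_cover_size"
  proof -
    have "inj_on y B"
    proof (rule inj_onI)
      fix p q assume pq: "p \<in> B" "q \<in> B" "y p = y q"
      have whiskers: "p \<in> whiskers" "q \<in> whiskers"
        by (rule subsetD[OF B pq(1)], rule subsetD[OF B pq(2)])
      have "y q \<in> F (fst q) (snd q)" using y whiskers(2) by blast
      then have "(fst p, snd p) = (fst q, snd q)"
        by (intro y_unique) (simp_all only: prod.collapse whiskers pq(3))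
      then show "p = q" by (simp only: prod.collapse)
    qed
    moreover have "inj_on x ({1..n} - S)" using inj by (rule inj_on_subset) blast
    moreover have "x ` ({1..n} - S) \<inter> y ` B = {}"
    proof -
      have "y p \<notin> x ` {1..n}" if "p \<in> B" for p using y B that by blast
      then have "y ` B \<subseteq> - x ` {1..n}" by (intro image_subsetI ComplI) simp
      moreover have "x ` ({1..n} - S) \<subseteq> x ` {1..n}" by (rule image_mono) blast
      ultimately show ?thesis by blast
    qed
    moreover have "finite B" using \<open>finite S\<close> by (simp add: B_def)
    ultimately have "card C = card ({1..n} - S) + card B"
      by (simp add: C_def card_Un_disjoint card_image)
    also have "\<dots> = (n - card S) + (\<Sum>i\<in>S. m i)"
      using S(1) \<open>finite S\<close> by (simp add: card_Diff_subset B_def)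
    finally show ?thesis using S(3) by (simp add: cover_size_def)
  qed
  ultimately show ?thesis by (rule that)
qed

text \<open>
  Supports of monomials in the facet ideal; larger sets of whiskers or of indices get smaller
  levels. A dependent set is recorded without whiskers: the product of its \<open>x i\<close> already lies in the
  ideal, and a chain of dependent sets then takes at most one level for each index that it adds,
  as \<^const>\<open>cover_size\<close> requires.
\<close>

definition whisker_sets :: "nat \<Rightarrow> 'v set set" where
  "whisker_sets k = {(\<Union>(i, j)\<in>A. F i j) | A.
     A \<subseteq> whiskers \<and> A \<noteq> {} \<and> \<not> dependent (fst ` A) \<and> max_cover_size - card A = k}"

definition dependent_sets :: "nat \<Rightarrow> 'v set set" where
  "dependent_sets k = {x ` D | D. D \<subseteq> {1..n} \<and> dependent D \<and> n - card D = k}"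

lemma whisker_setsI:
  "A \<subseteq> whiskers \<Longrightarrow> A \<noteq> {} \<Longrightarrow> \<not> dependent (fst ` A) \<Longrightarrow>
    (\<Union>(i, j)\<in>A. F i j) \<in> whisker_sets (max_cover_size - card A)"
  unfolding whisker_sets_def by blast

lemma dependent_setsI:
  "D \<subseteq> {1..n} \<Longrightarrow> dependent D \<Longrightarrow> x ` D \<in> dependent_sets (n - card D)"
  unfolding dependent_sets_def by blast

lemma x_image_subset_whiskers: "A \<subseteq> whiskers \<Longrightarrow> x ` fst ` A \<subseteq> (\<Union>(i, j)\<in>A. F i j)"
proof
  fix v assume A: "A \<subseteq> whiskers" and "v \<in> x ` fst ` A"
  then obtain p where p: "p \<in> A" "v = x (fst p)" by blast
  then have "p \<in> whiskers" using A by blast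
  then have "v \<in> F (fst p) (snd p)" unfolding p(2) by (intro x_in_F) auto
  then show "v \<in> (\<Union>(i, j)\<in>A. F i j)"
    using p(1) by (intro UN_I[of p]) (simp_all add: case_prod_beta)
qed

text \<open>
  The smaller support comes from the union of the two sets of whiskers if its index set is
  independent, and from the union of the two index sets otherwise. Since the two given supports
  differ but have the same level, this union is strictly larger than both sets.
\<close>

lemma level_union:
  assumes W: "W \<in> whisker_sets k \<union> dependent_sets k" and W': "W' \<in> whisker_sets k \<union> dependent_sets k"
    and "W \<noteq> W'"
  shows "\<exists>k'<k. \<exists>W''\<in>whisker_sets k' \<union> dependent_sets k'. W'' \<subseteq> W \<union> W'"
proof -
  have finite: "finite A" if "A \<subseteq> whiskers" for A using that by (rule finite_subset) auto
  have finD: "finite D" and cardD: "card D \<le> n" if "D \<subseteq> {1..n}" for D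
    using that finite_subset card_mono[of "{1..n}" D] by auto
  have grow: "card A < card (A \<union> B)" if "A \<noteq> B" "card A = card B" "finite A" "finite B" for A B :: "'c set"
  proof (rule psubset_card_mono)
    have "\<not> B \<subseteq> A" using card_subset_eq[of A B] that by auto
    then show "A \<subset> A \<union> B" by blast
  qed (use that in simp)
  have above: "n - card D < max_cover_size - card A"
    if "A \<subseteq> whiskers" "\<not> dependent (fst ` A)" "D \<subseteq> {1..n}" "dependent D" "fst ` A \<subseteq> D" for A D
  proof -
    have "fst ` A \<subset> D" using that by blast
    then have "card (fst ` A) < card D" using finD[OF that(3)] by (rule psubset_card_mono[rotated])
    then show ?thesis using card_whiskers_le[OF that(1,2)] cardD[OF that(3)] by linarith
  qed
  have mixed: "\<exists>k'<k. \<exists>W''\<in>whisker_sets k' \<union> dependent_sets k'. W'' \<subseteq> W \<union> W'"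
    if W: "W \<in> whisker_sets k" and W': "W' \<in> dependent_sets k" for W W'
  proof -
    obtain A where A: "W = (\<Union>(i, j)\<in>A. F i j)" "A \<subseteq> whiskers" "\<not> dependent (fst ` A)"
      "max_cover_size - card A = k"
      using W unfolding whisker_sets_def by blast
    obtain D where D: "W' = x ` D" "D \<subseteq> {1..n}" "dependent D" "n - card D = k"
      using W' unfolding dependent_sets_def by blast
    define E where "E = fst ` A \<union> D"
    have "fst ` A \<subseteq> {1..n}" using A(2) by auto
    then have E: "E \<subseteq> {1..n}" unfolding E_def using D(2) by (rule Un_least)
    have dep: "dependent E" by (rule dependent_mono[OF D(3)]) (simp add: E_def)
    have "n - card E < max_cover_size - card A"
      by (rule above[OF A(2,3) E dep]) (simp add: E_def)
    moreover have "x ` E \<subseteq> W \<union> W'"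
      unfolding E_def image_Un A(1) D(1) by (intro Un_mono x_image_subset_whiskers A(2) order_refl)
    ultimately show ?thesis using dependent_setsI[OF E dep] A(4) by blast
  qed
  consider "W \<in> whisker_sets k" "W' \<in> whisker_sets k" | "W \<in> whisker_sets k" "W' \<in> dependent_sets k"
    | "W \<in> dependent_sets k" "W' \<in> whisker_sets k" | "W \<in> dependent_sets k" "W' \<in> dependent_sets k"
    using W W' by blast
  then show ?thesis
  proof cases
    case 1
    obtain A where A: "W = (\<Union>(i, j)\<in>A. F i j)" "A \<subseteq> whiskers" "A \<noteq> {}" "\<not> dependent (fst ` A)"
      "max_cover_size - card A = k"
      using 1(1) unfolding whisker_sets_def by blast
    obtain B where B: "W' = (\<Union>(i, j)\<in>B. F i j)" "B \<subseteq> whiskers" "\<not> dependent (fst ` B)"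
      "max_cover_size - card B = k"
      using 1(2) unfolding whisker_sets_def by blast
    have AB: "A \<union> B \<subseteq> whiskers" "A \<union> B \<noteq> {}" using A B by auto
    have W_Un: "(\<Union>(i, j)\<in>A \<union> B. F i j) = W \<union> W'" unfolding A(1) B(1) by blast
    show ?thesis
    proof (cases "dependent (fst ` (A \<union> B))")
      case True
      have "n - card (fst ` (A \<union> B)) < max_cover_size - card A"
        by (rule above) (use A AB True in auto)
      moreover have "x ` fst ` (A \<union> B) \<in> dependent_sets (n - card (fst ` (A \<union> B)))"
        by (rule dependent_setsI) (use AB True in auto)
      ultimately show ?thesis using x_image_subset_whiskers[OF AB(1)] A(5) W_Un by blast
    next
      case False
      have "A \<noteq> B" using assms(3) A(1) B(1) by blast
      moreover have "card A = card B"
        using card_whiskers_le[OF A(2,4)] card_whiskers_le[OF B(2,3)] A(5) B(4) by linarith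
      ultimately have "card A < card (A \<union> B)" using grow[of A B] finite A B by blast
      then have "max_cover_size - card (A \<union> B) < k"
        using card_whiskers_le[OF AB(1) False] A(5) by linarith
      then show ?thesis using whisker_setsI[OF AB False] W_Un by blast
    qed
  next
    case 2
    then show ?thesis by (rule mixed)
  next
    case 3
    then show ?thesis using mixed[of W' W] by (simp add: Un_commute)
  next
    case 4
    obtain D where D: "W = x ` D" "D \<subseteq> {1..n}" "dependent D" "n - card D = k"
      using 4(1) unfolding dependent_sets_def by blast
    obtain E where E: "W' = x ` E" "E \<subseteq> {1..n}" "dependent E" "n - card E = k"
      using 4(2) unfolding dependent_sets_def by blast
    have "D \<noteq> E" using assms(3) D(1) E(1) by blast
    moreover have "card D = card E" using cardD[OF D(2)] cardD[OF E(2)] D(4) E(4) by linarith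
    ultimately have "card D < card (D \<union> E)" using grow[of D E] finD D E by blast
    moreover have DE: "D \<union> E \<subseteq> {1..n}" using D E by blast
    ultimately have "n - card (D \<union> E) < k" using cardD[OF DE] D(4) by linarith
    moreover have "x ` (D \<union> E) \<in> dependent_sets (n - card (D \<union> E))"
      by (rule dependent_setsI[OF DE]) (use D dependent_mono in blast)
    moreover have "x ` (D \<union> E) \<subseteq> W \<union> W'" using D(1) E(1) by blast
    ultimately show ?thesis by blast
  qed
qed

lemma facet_contains_level:
  assumes G: "G \<in> facets \<Delta>'"
  shows "\<exists>k<max_cover_size. \<exists>W\<in>whisker_sets k \<union> dependent_sets k. W \<subseteq> G"
proof -
  have dep: ?thesis if D: "D \<subseteq> {1..n}" "dependent D" "x ` D \<subseteq> G" for D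
  proof -
    have "D \<noteq> {}" using D(2) independent_empty by blast
    then have "card D > 0" using D(1) finite_subset[of D "{1..n}"] by (simp add: card_gt_0_iff)
    then have "n - card D < max_cover_size" using n_le_max_cover_size n by linarith
    then show ?thesis using dependent_setsI[OF D(1,2)] D(3) by blast
  qed
  show ?thesis
    using G
  proof (cases rule: facet_cases)
    case 1
    define D where "D = {i \<in> {1..n}. x i \<in> G}"
    have D: "x ` D = G" using 1 by (auto simp: D_def)
    moreover have "D \<subseteq> {1..n}" by (auto simp: D_def)
    moreover have "dependent D" using D G by (auto simp: dependent_def)
    ultimately show ?thesis using dep by blast
  next
    case (2 i j)
    show ?thesis
    proof (cases "dependent {i}")
      case True
      then show ?thesis using dep[of "{i}"] x_in_F[OF 2(1,2)] 2 by simp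
    next
      case False
      then have "F i j \<in> whisker_sets (max_cover_size - 1)"
        using whisker_setsI[of "{(i, j)}"] 2 by simp
      moreover have "max_cover_size - 1 < max_cover_size" using n_le_max_cover_size n by linarith
      ultimately show ?thesis using 2 by blast
    qed
  qed
qed

lemma level_contains_facet:
  assumes "W \<in> whisker_sets k \<union> dependent_sets k"
  shows "W \<subseteq> vertices \<Delta>' \<and> (\<exists>G\<in>facets \<Delta>'. G \<subseteq> W)"
  using assms
proof
  assume "W \<in> whisker_sets k"
  then obtain A where A: "W = (\<Union>(i, j)\<in>A. F i j)" "A \<subseteq> whiskers" "A \<noteq> {}"
    unfolding whisker_sets_def by blast
  then obtain i j where ij: "(i, j) \<in> A" by auto
  then have "F i j \<in> facets \<Delta>'" using A(2) F_facet by auto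
  moreover have "F i j \<subseteq> W" using A(1) ij by auto
  moreover have "W \<subseteq> vertices \<Delta>'" unfolding A(1) using A(2) F_subset_vertices by fast
  ultimately show ?thesis by blast
next
  assume "W \<in> dependent_sets k"
  then obtain D where "W = x ` D" "D \<subseteq> {1..n}" "dependent D" unfolding dependent_sets_def by blast
  then show ?thesis using x_in_vertices by (auto simp: dependent_def)
qed

lemma bight_facet_ideal_eq_ara:
  "bight (mpoly_ring (vertices \<Delta>')) (facet_ideal \<Delta>' :: ('v, 'k::field) mpolynomial set) =
   ara (mpoly_ring (vertices \<Delta>')) (facet_ideal \<Delta>' :: ('v, 'k) mpolynomial set)"
proof -
  have I: "facet_ideal \<Delta>' = Idl\<^bsub>mpoly_ring (vertices \<Delta>')\<^esub>
      (sqfree_monomial ` facets \<Delta>' :: ('v, 'k) mpolynomial set)"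
    unfolding facet_ideal_def sqfree_monomial_def ..
  obtain C where C: "minimal_vertex_cover (vertices \<Delta>') (facets \<Delta>') C" "card C = max_cover_size"
    by (rule minimal_vertex_cover_of_max_size)
  show ?thesis
    unfolding I
  proof (rule antisym[OF bight_sqfree_ideal_le_ara[OF finite_vertices facet_subset_vertices]])
    have "ara (mpoly_ring (vertices \<Delta>')) (Idl\<^bsub>mpoly_ring (vertices \<Delta>')\<^esub>
        (sqfree_monomial ` facets \<Delta>' :: ('v, 'k) mpolynomial set)) \<le> enat max_cover_size"
      by (rule ara_sqfree_ideal_le[OF finite_vertices facet_subset_vertices level_contains_facet
        facet_contains_level level_union])
    also have "\<dots> \<le> bight (mpoly_ring (vertices \<Delta>')) (Idl\<^bsub>mpoly_ring (vertices \<Delta>')\<^esub>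
        (sqfree_monomial ` facets \<Delta>' :: ('v, 'k) mpolynomial set))"
      using card_minimal_vertex_cover_le_bight[OF finite_vertices facet_subset_vertices C(1)]
      by (simp add: C(2))
    finally show "ara (mpoly_ring (vertices \<Delta>')) (Idl\<^bsub>mpoly_ring (vertices \<Delta>')\<^esub>
        (sqfree_monomial ` facets \<Delta>' :: ('v, 'k) mpolynomial set)) \<le>
      bight (mpoly_ring (vertices \<Delta>')) (Idl\<^bsub>mpoly_ring (vertices \<Delta>')\<^esub>
        (sqfree_monomial ` facets \<Delta>' :: ('v, 'k) mpolynomial set))" .
  qed
qed

end

theorem corollary4p2:
  fixes \<Delta> \<Delta>' :: "'v set set"
    and n :: nat and x :: "nat \<Rightarrow> 'v"
    and m :: "nat \<Rightarrow> nat" and F :: "nat \<Rightarrow> nat \<Rightarrow> 'v set"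
    and I :: "(('v \<Rightarrow>\<^sub>0 nat) \<Rightarrow>\<^sub>0 'k::field) set"
  assumes "simplicial_complex \<Delta>"
    and "n \<ge> 1" and "inj_on x {1..n}" and "vertices \<Delta> = x ` {1..n}"
    and "\<forall>i\<in>{1..n}. m i \<ge> 1"
    and "\<forall>i\<in>{1..n}. \<forall>j\<in>{1..m i}. finite (F i j) \<and> face_dim (F i j) \<ge> 1"
    and "\<forall>i\<in>{1..n}. \<forall>j\<in>{1..m i}. F i j \<inter> vertices \<Delta> = {x i}"
    and "\<forall>i\<in>{1..n}. \<forall>j\<in>{1..m i}. \<forall>k\<in>{1..m i}. j \<noteq> k \<longrightarrow> F i j \<inter> F i k = {x i}"
    and "\<forall>i\<in>{1..n}. \<forall>h\<in>{1..n}. i \<noteq> h \<longrightarrow>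
           (\<forall>j\<in>{1..m i}. \<forall>k\<in>{1..m h}. F i j \<inter> F h k = {})"
    and "\<Delta>' = \<Delta> \<union> (\<Union>i\<in>{1..n}. \<Union>j\<in>{1..m i}. simplex_on (F i j))"
    and "I = facet_ideal \<Delta>'"
  shows "bight (mpoly_ring (vertices \<Delta>')) I = ara (mpoly_ring (vertices \<Delta>')) I"
proof -
  interpret whiskered_complex \<Delta> \<Delta>' n x m F
    using assms(1-10) by unfold_locales blast+
  show ?thesis unfolding assms(11) by (rule bight_facet_ideal_eq_ara)
qed

end
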